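(* Let $f:\mathbb{R}^d\to\mathbb{R}^d$ be globally Lipschitz continuous with Lipschitz constant $C_f>0$, let $g\in C^3_b(\mathbb{R}^d,\mathcal{L}(\mathbb{R}^m,\mathbb{R}^d))$, put $C_g=\max\{\|g\|_\infty,\|Dg\|_\infty,\|D^2g\|_\infty,\|D^3g\|_\infty\}$ and assume $C_g>0$; let $\mathbf{x}=(x,\mathbb{X})$ be a $\nu$-Hölder rough path on $[a,b]$ over $\mathbb{R}^m$. Let $y$ be the solution on $[a,b]$ of $$dy_t=f(y_t)\,dt+g(y_t)\,dx_t$$ with initial value $y_a\in\mathbb{R}^d$. Then $$\|y\|_{\infty,[a,b]}\le\Big[\|y_a\|+\Big(\frac{\|f(0)\|}{C_f}+\frac1{C_p}\Big)N_{[a,b]}(\mathbf{x})\Big]e^{4C_f(b-a)},$$ $$|||y,R^y|||_{p\text{-var},[a,b]}\le\Big[\|y_a\|+\Big(\frac{\|f(0)\|}{C_f}+\frac1{C_p}\Big)N_{[a,b]}(\mathbf{x})\Big]e^{4C_f(b-a)}N_{[a,b]}(\mathbf{x})^{\frac{p-1}{p}}-\|y_a\|,$$ where $N_{[a,b]}(\mathbf{x}):=N_{\gamma,[a,b],p}(\mathbf{x})$ with $\gamma=\frac1{4C_pC_g}$.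
   Context: Parameters: $\frac13<\alpha<\nu<\frac12$, $p=\frac1\alpha$, $q=\frac p2$ are fixed. Write $y_{s,t}=y_t-y_s$. $C^3_b$ means three times continuously differentiable with $g$ and its derivatives up to order 3 bounded. Norms on finite-dimensional spaces are fixed, (multi)linear maps carry operator norms, and norms are compatible, i.e. $\|A\xi\|\le\|A\|\|\xi\|$ also when $A\in\mathcal{L}(\mathbb{R}^m,\mathcal{L}(\mathbb{R}^m,\mathbb{R}^d))\cong\mathcal{L}(\mathbb{R}^m\otimes\mathbb{R}^m,\mathbb{R}^d)$ acts on $\xi\in\mathbb{R}^m\otimes\mathbb{R}^m$ by $A(u\otimes v)=(Au)v$. Seminorms on a compact interval $I$: $\|y\|_{\infty,I}=\sup_{t\in I}\|y_t\|$; $|||y|||_{p\text{-var},I}=\big(\sup_\Pi\sum_i\|y_{t_i,t_{i+1}}\|^p\big)^{1/p}$ over finite partitions $\Pi$ of $I$; for two-parameter functions $|||R|||_{q\text{-var},I^2}=\big(\sup_\Pi\sum_i\|R_{t_i,t_{i+1}}\|^q\big)^{1/q}$; $C^\alpha(I,W)$ is the space of $\alpha$-Hölder paths, and $C^{2\alpha}(I^2,W)$ the continuous two-parameter functions with $\sup_{s<t}\|R_{s,t}\|/|t-s|^{2\alpha}<\infty$. Rough path: a $\nu$-Hölder rough path on $I$ over $\mathbb{R}^m$ is $\mathbf{x}=(x,\mathbb{X})$ with $x\in C^\nu(I,\mathbb{R}^m)$, $\mathbb{X}\in C^{2\nu}(I^2,\mathbb{R}^m\otimes\mathbb{R}^m)$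 and $\mathbb{X}_{s,t}-\mathbb{X}_{s,u}-\mathbb{X}_{u,t}=x_{s,u}\otimes x_{u,t}$ for $s\le u\le t$. Set $|||\mathbf{x}|||_{p\text{-var},I}=\big(|||x|||_{p\text{-var},I}^p+|||\mathbb{X}|||_{q\text{-var},I^2}^q\big)^{1/p}$. Controlled paths: $(y,y')\in\mathcal{D}^{2\alpha}_x(I)$ with values in $W$ means $y\in C^\alpha(I,W)$, $y'\in C^\alpha(I,\mathcal{L}(\mathbb{R}^m,W))$ and $y_{s,t}=y'_sx_{s,t}+R^y_{s,t}$ for $s\le t$ with $R^y\in C^{2\alpha}(I^2,W)$. For a controlled path $(Y,Y')$ with values in $\mathcal{L}(\mathbb{R}^m,\mathbb{R}^d)$ the Gubinelli rough integral is $\int_s^tY_u\,dx_u=\lim_{|\Pi|\to0}\sum_{[u,v]\in\Pi}\big(Y_ux_{u,v}+Y'_u\mathbb{X}_{u,v}\big)$ over finite partitions $\Pi$ of $[s,t]$. Put $|||y,R^y|||_{p\text{-var},[s,t]}=|||y|||_{p\text{-var},[s,t]}+|||R^y|||_{q\text{-var},[s,t]^2}$. $C_p>1$ is a fixed constant, independent of $\mathbf{x}$ and of the integrand, such that $\|\int_s^tY_u\,dx_u-Y_sx_{s,t}-Y'_s\mathbb{X}_{s,t}\|\le C_p\big(|||x|||_{p\text{-var},[s,t]}|||R^Y|||_{q\text{-var},[s,t]^2}+|||Y'|||_{p\text{-var},[s,t]}|||\mathbb{X}|||_{q\text{-var},[s,t]^2}\big)$ for all such controlled paths (it exists by the sewing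 lemma). Solution: a path $y$ with $(y,y')\in\mathcal{D}^{2\alpha}_x([a,b])$, $y'_t=g(y_t)$, initial value $y_a$, and $y_t=y_a+\int_a^tf(y_u)\,du+\int_a^tg(y_u)\,dx_u$ for all $t\in[a,b]$, where the integrand $g(y)$ has Gubinelli derivative $[g(y)]'_s=Dg(y_s)g(y_s)$, i.e. $u\otimes v\mapsto(Dg(y_s)[g(y_s)u])v$. $R^y$ is the remainder of $(y,y')$. Greedy times: for $\gamma>0$, $\tau_0=\min I$, $\tau_{i+1}=\inf\{t>\tau_i:\ |||\mathbf{x}|||_{p\text{-var},[\tau_i,t]}=\gamma\}\wedge\max I$ (with $\inf\emptyset=+\infty$); $N_{\gamma,I,p}(\mathbf{x})$ is the smallest index $i$ with $\tau_i=\max I$. *)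

theory Defs
  imports "HOL-Analysis.Analysis"
begin

section \<open>Finite-dimensional normed spaces and tensor products\<close>

text \<open>
  The spaces \<open>R^m\<close>, \<open>R^d\<close> carry arbitrary fixed norms, not necessarily Euclidean ones.  They are
  therefore represented by types of class \<^class>\<open>banach\<close> subject to \<open>finite_dim\<close>;
  completeness is automatic in finite dimension, so the class is no restriction.
  (Multi)linear maps are bounded linear functions (nested for several arguments), whose library
  norm is the operator norm.
\<close>

definition finite_dim :: "'a::real_vector itself \<Rightarrow> bool" where
  "finite_dim _ \<longleftrightarrow> (\<exists>B::'a set. finite B \<and> span B = UNIV)"

text \<open>
  \<open>R^m \<otimes> R^m\<close> also carries an arbitrary norm (subject to compatibility), so it is a type \<open>'t\<close> together
  with a map \<open>T u v = u \<otimes> v\<close> having the universal property of the tensor product.  The property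
  is demanded for scalar-valued bilinear maps only; \<open>tensor_apply_unique\<close> below derives it for
  every finite-dimensional target.
\<close>

definition is_tensor_product :: "('v::real_vector \<Rightarrow> 'v \<Rightarrow> 't::real_vector) \<Rightarrow> bool" where
  "is_tensor_product T \<longleftrightarrow> bilinear T \<and>
     (\<forall>\<beta> :: 'v \<Rightarrow> 'v \<Rightarrow> real. bilinear \<beta> \<longrightarrow> (\<exists>!L. linear L \<and> (\<forall>u v. L (T u v) = \<beta> u v)))"

text \<open>The action \<open>A (u \<otimes> v) = (A u) v\<close>, extended linearly.\<close>

definition tensor_apply ::
  "('v::real_normed_vector \<Rightarrow> 'v \<Rightarrow> 't::real_normed_vector) \<Rightarrow>
   ('v \<Rightarrow>\<^sub>L 'v \<Rightarrow>\<^sub>L 'w::real_normed_vector) \<Rightarrow> 't \<Rightarrow> 'w" where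
  "tensor_apply T A = (THE L. linear L \<and> (\<forall>u v. L (T u v) = A u v))"

lemma ex1_tensor_lift:
  fixes T :: "'v::real_normed_vector \<Rightarrow> 'v \<Rightarrow> 't::real_normed_vector"
    and A :: "'v \<Rightarrow>\<^sub>L 'v \<Rightarrow>\<^sub>L 'w::real_normed_vector"
  assumes T: "is_tensor_product T" and fd: "finite_dim TYPE('w)"
  shows "\<exists>!L. linear L \<and> (\<forall>u v. L (T u v) = A u v)"
proof -
  obtain B0 :: "'w set" where B0: "finite B0" "span B0 = UNIV"
    using fd by (auto simp: finite_dim_def)
  obtain B where B': "B \<subseteq> B0" "independent B" "B0 \<subseteq> span B"
    using maximal_independent_subset[of B0] by blast
  then have "span B = UNIV"
    using B0(2) span_mono[OF B'(3)] by (auto simp: span_span)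
  with B' have B: "B \<subseteq> B0" "independent B" "span B = UNIV" by auto
  have fin: "finite B" using B(1) B0(1) finite_subset by blast
  define c where "c b w = representation B w b" for b w
  have lin_c: "linear (c b)" for b
    unfolding c_def by (rule linearI) (use B in \<open>auto simp: representation_add representation_scale\<close>)
  have expand: "(\<Sum>b\<in>B. c b w *\<^sub>R b) = w" for w
    unfolding c_def using sum_representation_eq[of B w B] B fin by auto
  have bil: "bilinear (\<lambda>u v. c b (A u v))" for b
    unfolding bilinear_def
    by (auto intro!: linearI simp: blinfun.add_right blinfun.add_left blinfun.scaleR_left
        blinfun.scaleR_right linear_add[OF lin_c] linear_scale[OF lin_c])
  have ex1: "\<exists>!L. linear L \<and> (\<forall>u v. L (T u v) = c b (A u v))" for b
    using T bil[of b] unfolding is_tensor_product_def by blast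
  define L where "L b = (THE L. linear L \<and> (\<forall>u v. L (T u v) = c b (A u v)))" for b
  have L: "linear (L b)" "L b (T u v) = c b (A u v)" for b u v
    using theI'[OF ex1[of b]] unfolding L_def by blast+
  show ?thesis
  proof (rule ex1I)
    have "linear (\<lambda>\<xi>. \<Sum>b\<in>B. L b \<xi> *\<^sub>R b)"
      by (rule linearI)
        (simp_all add: linear_add[OF L(1)] linear_scale[OF L(1)] scaleR_add_left sum.distrib
          scaleR_sum_right)
    then show "linear (\<lambda>\<xi>. \<Sum>b\<in>B. L b \<xi> *\<^sub>R b) \<and> (\<forall>u v. (\<Sum>b\<in>B. L b (T u v) *\<^sub>R b) = A u v)"
      by (simp add: L(2) expand)
  next
    fix M assume M: "linear M \<and> (\<forall>u v. M (T u v) = A u v)"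
    have "c b \<circ> M = L b" for b
    proof -
      have "linear (c b \<circ> M)" using M lin_c linear_compose by blast
      moreover have "(c b \<circ> M) (T u v) = c b (A u v)" for u v using M by simp
      ultimately show ?thesis using ex1[of b] L[of b] by blast
    qed
    then have "L b \<xi> = c b (M \<xi>)" for b \<xi> by (simp add: fun_eq_iff)
    then show "M = (\<lambda>\<xi>. \<Sum>b\<in>B. L b \<xi> *\<^sub>R b)"
      by (simp add: expand)
  qed
qed

lemma tensor_apply_unique:
  fixes T :: "'v::real_normed_vector \<Rightarrow> 'v \<Rightarrow> 't::real_normed_vector"
    and A :: "'v \<Rightarrow>\<^sub>L 'v \<Rightarrow>\<^sub>L 'w::real_normed_vector"
  assumes "is_tensor_product T" "finite_dim TYPE('w)"
  shows "linear (tensor_apply T A)" "tensor_apply T A (T u v) = A u v"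
    and "linear L \<Longrightarrow> (\<And>u v. L (T u v) = A u v) \<Longrightarrow> L = tensor_apply T A"
  using theI'[OF ex1_tensor_lift[OF assms, of A]] ex1_tensor_lift[OF assms, of A]
  unfolding tensor_apply_def by blast+

lemma is_tensor_product_outer:
  "is_tensor_product (\<lambda>(u::real^'n) (v::real^'n). (\<chi> i j. u $ i * v $ j) :: real^'n^'n)"
  (is "is_tensor_product ?T")
proof -
  have bilT: "bilinear ?T"
    unfolding bilinear_def by (auto intro!: linearI simp: vec_eq_iff algebra_simps)
  have expand: "M = (\<Sum>i\<in>UNIV. \<Sum>j\<in>UNIV. M $ i $ j *\<^sub>R ?T (axis i 1) (axis j 1))" for M :: "real^'n^'n"
    by (simp add: vec_eq_iff axis_def mult_delta_left mult_delta_right sum.delta)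
  have vexp: "u = (\<Sum>i\<in>UNIV. u $ i *\<^sub>R axis i 1)" for u :: "real^'n"
    by (simp add: vec_eq_iff axis_def mult_delta_left mult_delta_right sum.delta)
  have "\<exists>!L. linear L \<and> (\<forall>u v. L (?T u v) = \<beta> u v)" if b: "bilinear \<beta>"
    for \<beta> :: "real^'n \<Rightarrow> real^'n \<Rightarrow> real"
  proof (rule ex1I)
    let ?L = "\<lambda>M::real^'n^'n. \<Sum>i\<in>UNIV. \<Sum>j\<in>UNIV. M $ i $ j * \<beta> (axis i 1) (axis j 1)"
    have "?L (?T u v) = \<beta> u v" for u v
    proof -
      have l1: "linear (\<lambda>u. \<beta> u v)" for v using b by (simp add: bilinear_def)
      have l2: "linear (\<beta> u)" for u using b by (simp add: bilinear_def)
      have "\<beta> u v = \<beta> (\<Sum>i\<in>UNIV. u $ i *\<^sub>R axis i 1) v"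
        by (rule arg_cong[OF vexp, where f = "\<lambda>w. \<beta> w v"])
      also have "\<dots> = (\<Sum>i\<in>UNIV. u $ i * \<beta> (axis i 1) v)"
        by (simp add: linear_sum[OF l1] linear_scale[OF l1])
      also have "\<dots> = (\<Sum>i\<in>UNIV. u $ i * \<beta> (axis i 1) (\<Sum>j\<in>UNIV. v $ j *\<^sub>R axis j 1))"
        by (rule arg_cong[OF vexp, where f = "\<lambda>w. \<Sum>i\<in>UNIV. u $ i * \<beta> (axis i 1) w"])
      also have "\<dots> = ?L (?T u v)"
        by (simp add: linear_sum[OF l2] linear_scale[OF l2] sum_distrib_left mult.assoc)
      finally show ?thesis by (rule sym)
    qed
    moreover have "linear ?L"
      by (rule linearI) (simp_all add: distrib_right sum.distrib sum_distrib_left mult.assoc)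
    ultimately show "linear ?L \<and> (\<forall>u v. ?L (?T u v) = \<beta> u v)" by blast
  next
    fix L assume L: "linear L \<and> (\<forall>u v. L (?T u v) = \<beta> u v)"
    show "L = (\<lambda>M. \<Sum>i\<in>UNIV. \<Sum>j\<in>UNIV. M $ i $ j * \<beta> (axis i 1) (axis j 1))"
    proof
      fix M
      have "L M = L (\<Sum>i\<in>UNIV. \<Sum>j\<in>UNIV. M $ i $ j *\<^sub>R ?T (axis i 1) (axis j 1))"
        by (rule arg_cong[OF expand])
      also have "\<dots> = (\<Sum>i\<in>UNIV. \<Sum>j\<in>UNIV. M $ i $ j * L (?T (axis i 1) (axis j 1)))"
        using L by (simp only: linear_sum linear_scale real_scaleR_def)
      finally show "L M = (\<Sum>i\<in>UNIV. \<Sum>j\<in>UNIV. M $ i $ j * \<beta> (axis i 1) (axis j 1))"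
        using L by simp
    qed
  qed
  with bilT show ?thesis unfolding is_tensor_product_def by blast
qed

section \<open>Variation and Hoelder seminorms\<close>

text \<open>
  A partition of \<open>[s,t]\<close> is its strictly increasing list of points; \<open>steps\<close> lists its
  subintervals \<open>(u,v)\<close>.
\<close>

definition partitions :: "real \<Rightarrow> real \<Rightarrow> real list set" where
  "partitions s t = {ts. ts \<noteq> [] \<and> hd ts = s \<and> last ts = t \<and> sorted_wrt (<) ts}"

definition steps :: "real list \<Rightarrow> (real \<times> real) list" where
  "steps ts = zip ts (tl ts)"

text \<open>
  The suprema are real-valued, hence meaningful only when the variation is finite.  This is the
  case for all the paths they are applied to: \<open>\<beta>\<close>-Hoelder regularity gives finite
  \<open>r\<close>-variation for \<open>r \<ge> 1/\<beta>\<close>.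
\<close>

definition pvar2 :: "real \<Rightarrow> real \<Rightarrow> real \<Rightarrow> (real \<Rightarrow> real \<Rightarrow> 'a::real_normed_vector) \<Rightarrow> real" where
  "pvar2 r s t R =
     (SUP ts\<in>partitions s t. \<Sum>(u, v)\<leftarrow>steps ts. norm (R u v) powr r) powr (1 / r)"

definition pvar :: "real \<Rightarrow> real \<Rightarrow> real \<Rightarrow> (real \<Rightarrow> 'a::real_normed_vector) \<Rightarrow> real" where
  "pvar r s t y = pvar2 r s t (\<lambda>u v. y v - y u)"

definition hoelder :: "real \<Rightarrow> real set \<Rightarrow> (real \<Rightarrow> 'a::real_normed_vector) \<Rightarrow> bool" where
  "hoelder \<beta> I y \<longleftrightarrow> (\<exists>C. \<forall>s\<in>I. \<forall>t\<in>I. norm (y t - y s) \<le> C * \<bar>t - s\<bar> powr \<beta>)"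

definition hoelder2 ::
  "real \<Rightarrow> real set \<Rightarrow> (real \<Rightarrow> real \<Rightarrow> 'a::real_normed_vector) \<Rightarrow> bool" where
  "hoelder2 \<beta> I R \<longleftrightarrow> continuous_on (I \<times> I) (\<lambda>(s, t). R s t) \<and>
     (\<exists>C. \<forall>s\<in>I. \<forall>t\<in>I. s < t \<longrightarrow> norm (R s t) \<le> C * (t - s) powr \<beta>)"

section \<open>Rough paths, controlled paths and the rough integral\<close>

text \<open>
  Throughout, \<open>T\<close> is the tensor map, \<open>x\<close> the path and \<open>X\<close> its second-order process.  Paths are
  total functions of which only the restriction to the interval in question matters.
\<close>

definition rough_path ::
  "real \<Rightarrow> ('v::real_normed_vector \<Rightarrow> 'v \<Rightarrow> 't::real_normed_vector) \<Rightarrow> real \<Rightarrow> real \<Rightarrow>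
   (real \<Rightarrow> 'v) \<Rightarrow> (real \<Rightarrow> real \<Rightarrow> 't) \<Rightarrow> bool" where
  "rough_path \<nu> T a b x X \<longleftrightarrow>
     hoelder \<nu> {a..b} x \<and> hoelder2 (2 * \<nu>) {a..b} X \<and>
     (\<forall>s u t. a \<le> s \<and> s \<le> u \<and> u \<le> t \<and> t \<le> b \<longrightarrow>
        X s t - X s u - X u t = T (x u - x s) (x t - x u))"

definition rp_pvar ::
  "real \<Rightarrow> real \<Rightarrow> real \<Rightarrow> (real \<Rightarrow> 'v::real_normed_vector) \<Rightarrow>
   (real \<Rightarrow> real \<Rightarrow> 't::real_normed_vector) \<Rightarrow> real" where
  "rp_pvar p s t x X = (pvar p s t x powr p + pvar2 (p / 2) s t X powr (p / 2)) powr (1 / p)"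

text \<open>
  The remainder is given by the same formula for \<open>s > t\<close>; this has no effect on
  \<open>controlled_path\<close>, since there it is continuous anyway and all bounds concern \<open>s \<le> t\<close>.
\<close>

definition remainder ::
  "(real \<Rightarrow> 'v::real_normed_vector) \<Rightarrow> (real \<Rightarrow> 'w::real_normed_vector) \<Rightarrow>
   (real \<Rightarrow> 'v \<Rightarrow>\<^sub>L 'w) \<Rightarrow> real \<Rightarrow> real \<Rightarrow> 'w" where
  "remainder x y y' s t = y t - y s - y' s (x t - x s)"

definition controlled_path ::
  "real \<Rightarrow> (real \<Rightarrow> 'v::real_normed_vector) \<Rightarrow> real \<Rightarrow> real \<Rightarrow>
   (real \<Rightarrow> 'w::real_normed_vector) \<Rightarrow> (real \<Rightarrow> 'v \<Rightarrow>\<^sub>L 'w) \<Rightarrow> bool" where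
  "controlled_path \<alpha> x a b y y' \<longleftrightarrow>
     hoelder \<alpha> {a..b} y \<and> hoelder \<alpha> {a..b} y' \<and> hoelder2 (2 * \<alpha>) {a..b} (remainder x y y')"

definition has_rough_integral ::
  "('v::real_normed_vector \<Rightarrow> 'v \<Rightarrow> 't::real_normed_vector) \<Rightarrow> (real \<Rightarrow> 'v) \<Rightarrow> (real \<Rightarrow> real \<Rightarrow> 't) \<Rightarrow>
   (real \<Rightarrow> 'v \<Rightarrow>\<^sub>L 'w::real_normed_vector) \<Rightarrow> (real \<Rightarrow> 'v \<Rightarrow>\<^sub>L 'v \<Rightarrow>\<^sub>L 'w) \<Rightarrow> real \<Rightarrow> real \<Rightarrow> 'w \<Rightarrow> bool"
  where
  "has_rough_integral T x X Y Y' s t J \<longleftrightarrow>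
     (\<forall>\<epsilon>>0. \<exists>\<delta>>0. \<forall>ts\<in>partitions s t. (\<forall>(u, v)\<in>set (steps ts). v - u < \<delta>) \<longrightarrow>
        norm ((\<Sum>(u, v)\<leftarrow>steps ts. Y u (x v - x u) + tensor_apply T (Y' u) (X u v)) - J) < \<epsilon>)"

section \<open>Rough differential equations\<close>

text \<open>\<open>g1\<close>, \<open>g2\<close>, \<open>g3\<close> are the first three derivatives of \<open>g\<close>.\<close>

definition C3_bounded ::
  "('d::real_normed_vector \<Rightarrow> 'w::real_normed_vector) \<Rightarrow> ('d \<Rightarrow> 'd \<Rightarrow>\<^sub>L 'w) \<Rightarrow>
   ('d \<Rightarrow> 'd \<Rightarrow>\<^sub>L 'd \<Rightarrow>\<^sub>L 'w) \<Rightarrow> ('d \<Rightarrow> 'd \<Rightarrow>\<^sub>L 'd \<Rightarrow>\<^sub>L 'd \<Rightarrow>\<^sub>L 'w) \<Rightarrow> bool" where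
  "C3_bounded g g1 g2 g3 \<longleftrightarrow>
     (\<forall>z. (g has_derivative g1 z) (at z)) \<and>
     (\<forall>z. (g1 has_derivative g2 z) (at z)) \<and>
     (\<forall>z. (g2 has_derivative g3 z) (at z)) \<and> continuous_on UNIV g3 \<and>
     bounded (range g) \<and> bounded (range g1) \<and> bounded (range g2) \<and> bounded (range g3)"

text \<open>
  The composition \<open>g1 (y t) o\<^sub>L g (y t)\<close> is the Gubinelli derivative
  \<open>u \<mapsto> (v \<mapsto> (Dg(y\<^sub>t)[g(y\<^sub>t) u]) v)\<close> of \<open>g(y)\<close>.  The last clause says that
  \<open>y t - y a - \<integral>\<^sub>a\<^sup>t f(y) du\<close> is the rough integral of \<open>g(y)\<close> over \<open>[a,t]\<close>.
\<close>

definition rde_solution ::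
  "real \<Rightarrow> ('v::real_normed_vector \<Rightarrow> 'v \<Rightarrow> 't::real_normed_vector) \<Rightarrow> (real \<Rightarrow> 'v) \<Rightarrow>
   (real \<Rightarrow> real \<Rightarrow> 't) \<Rightarrow> ('d::real_normed_vector \<Rightarrow> 'd) \<Rightarrow> ('d \<Rightarrow> 'v \<Rightarrow>\<^sub>L 'd) \<Rightarrow>
   ('d \<Rightarrow> 'd \<Rightarrow>\<^sub>L 'v \<Rightarrow>\<^sub>L 'd) \<Rightarrow> real \<Rightarrow> real \<Rightarrow> (real \<Rightarrow> 'd) \<Rightarrow> bool" where
  "rde_solution \<alpha> T x X f g g1 a b y \<longleftrightarrow>
     controlled_path \<alpha> x a b y (\<lambda>t. g (y t)) \<and>
     (\<forall>t\<in>{a..b}. has_rough_integral T x X (\<lambda>u. g (y u)) (\<lambda>u. g1 (y u) o\<^sub>L g (y u)) a t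
        (y t - y a - integral {a..t} (\<lambda>u. f (y u))))"

section \<open>Greedy times\<close>

primrec greedy_time ::
  "real \<Rightarrow> real \<Rightarrow> real \<Rightarrow> real \<Rightarrow> (real \<Rightarrow> 'v::real_normed_vector) \<Rightarrow>
   (real \<Rightarrow> real \<Rightarrow> 't::real_normed_vector) \<Rightarrow> nat \<Rightarrow> real" where
  "greedy_time \<gamma> p a b x X 0 = a"
| "greedy_time \<gamma> p a b x X (Suc i) =
     (let \<tau> = greedy_time \<gamma> p a b x X i; S = {t. \<tau> < t \<and> t \<le> b \<and> rp_pvar p \<tau> t x X = \<gamma>}
      in if S = {} then b else min (Inf S) b)"

definition greedy_count ::
  "real \<Rightarrow> real \<Rightarrow> real \<Rightarrow> real \<Rightarrow> (real \<Rightarrow> 'v::real_normed_vector) \<Rightarrow>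
   (real \<Rightarrow> real \<Rightarrow> 't::real_normed_vector) \<Rightarrow> nat" where
  "greedy_count \<gamma> p a b x X = (LEAST i. greedy_time \<gamma> p a b x X i = b)"

end

theory Submission
  imports Defs
begin

text \<open>
  Write \<open>R\<close> for the remainder of \<open>y\<close>, \<open>C\<close> for \<open>C\<^sub>g\<close>, \<open>\<Phi> = \<parallel>f(0)\<parallel> / C\<^sub>f\<close>, and \<open>K s t\<close> for the sum of the
  \<open>p\<close>-variation of \<open>y\<close> and the \<open>q\<close>-variation of \<open>R\<close> over \<open>[s,t]\<close>.

  Local estimate.  The sewing bound expresses \<open>R\<close> by the drift, the second-order term and an error
  that involves the remainder of \<open>g(y)\<close>.  Expanding \<open>g\<close> around \<open>y\<^sub>s + g(y\<^sub>s) x\<^sub>s\<^sub>t\<close> bounds that remainder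
  linearly in \<open>R\<close>, plus a term in \<open>x\<close> alone (\<open>remainder_compose_bound\<close>).  Where \<open>C\<close> times the rough
  path norm is at most \<open>1 / (4 C\<^sub>p)\<close>, i.e. on a greedy interval, the terms containing \<open>y\<close> and \<open>R\<close> are
  absorbed and \<open>K s t \<le> 4 \<integral> \<parallel>f(y)\<parallel> + 3 / (4 C\<^sub>p)\<close> remains (\<open>interval_estimate\<close>).  Gronwall's inequality
  gives \<open>\<parallel>y\<^sub>s\<parallel> + K s t + \<Phi> \<le> (\<parallel>y\<^sub>s\<parallel> + \<Phi> + 3 / (4 C\<^sub>p)) e\<^bsup>4 C\<^sub>f (t - s)\<^esup>\<close> (\<open>interval_growth\<close>).

  Gluing.  Let \<open>K\<^sub>i\<close> be the value of \<open>K\<close> on the greedy interval number \<open>i\<close>.  There are finitely many such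
  intervals because the \<open>p\<close>-th power of the rough path norm equals \<open>\<gamma>\<^sup>p\<close> on each complete one and is at
  most a multiple of its length (\<open>greedy_count_attained\<close>).  Iterating the local bound for
  \<open>\<parallel>y\<^sub>a\<parallel> + K\<^sub>0 + \<dots> + K\<^sub>i\<close> gives the bound on the supremum (\<open>sum_K_le\<close>).  The variation norm of \<open>y\<close> is
  subadditive under concatenation by Minkowski's inequality.  That of \<open>R\<close> is not, because \<open>R\<close> is not
  additive: cutting \<open>[v,w]\<close> at \<open>u\<close> produces the extra term \<open>(g(y\<^sub>u) - g(y\<^sub>v)) x\<^sub>u\<^sub>w\<close>, which is at most
  \<open>2 C \<gamma> = 1 / (2 C\<^sub>p)\<close>.  Hence \<open>K a b \<le> K\<^sub>0 + \<dots> + K\<^sub>N\<^sub>-\<^sub>1 + (N - 1) / (2 C\<^sub>p)\<close> (\<open>K_le_sum\<close>).  The additional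
  terms fit below the claimed bound since the local constant is \<open>3/4\<close> rather than \<open>1\<close> and the factor
  \<open>N\<^bsup>(p - 1) / p\<^esup>\<close> is at least \<open>\<surd>2 > 5/4\<close> as soon as \<open>N \<ge> 2\<close>.
\<close>

section \<open>Partitions of an interval\<close>

lemma steps_simps [simp]:
  "steps [] = []" "steps [u] = []" "steps (u # v # l) = (u, v) # steps (v # l)"
  by (simp_all add: steps_def)

lemma singleton_partition [simp]: "[s] \<in> partitions s t \<longleftrightarrow> s = t"
  by (auto simp: partitions_def)

lemma partition_Cons:
  "u # v # l \<in> partitions s t \<longleftrightarrow> u = s \<and> s < v \<and> v # l \<in> partitions v t"
  by (force simp: partitions_def)

lemma partition_induct [consumes 1, case_names single step]:
  assumes "ts \<in> partitions s t"
    and "\<And>s. s = t \<Longrightarrow> P s [s]"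
    and "\<And>s v l. s < v \<Longrightarrow> v # l \<in> partitions v t \<Longrightarrow> P v (v # l) \<Longrightarrow> P s (s # v # l)"
  shows "P s ts"
  using assms(1)
proof (induction ts arbitrary: s)
  case Nil
  then show ?case by (simp add: partitions_def)
next
  case (Cons u l)
  show ?case
  proof (cases l)
    case Nil
    then show ?thesis using Cons.prems assms(2) by (auto simp: partitions_def)
  next
    case (Cons v l')
    then show ?thesis using Cons.IH Cons.prems assms(3) by (auto simp: partition_Cons)
  qed
qed

lemma partition_le: "ts \<in> partitions s t \<Longrightarrow> s \<le> t"
  by (induction rule: partition_induct) auto

lemma partition_steps_bounds:
  assumes "ts \<in> partitions s t" "(u, v) \<in> set (steps ts)"
  shows "s \<le> u" "u < v" "v \<le> t"
  using assms by (induction rule: partition_induct) (auto dest: partition_le)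

lemma partition_append:
  assumes "ts1 \<in> partitions s u" "ts2 \<in> partitions u t"
  obtains ts where "ts \<in> partitions s t" "steps ts = steps ts1 @ steps ts2"
proof -
  have "\<exists>ts\<in>partitions s t. steps ts = steps ts1 @ steps ts2"
    using assms(1)
  proof (induction rule: partition_induct)
    case (single s)
    then show ?case using assms(2) by auto
  next
    case (step s v l)
    then obtain ts where ts: "ts \<in> partitions v t" "steps ts = steps (v # l) @ steps ts2" by blast
    then obtain l' where "ts = v # l'"
      by (cases ts) (auto simp: partitions_def)
    then have "s # ts \<in> partitions s t" "steps (s # ts) = steps (s # v # l) @ steps ts2"
      using step.hyps ts by (simp_all add: partition_Cons)
    then show ?case by blast
  qed
  then show ?thesis using that by blast
qed

lemma interval_partition:
  assumes "s < t"
  shows "[s, t] \<in> partitions s t"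
  using assms by (simp add: partition_Cons)

lemma partitions_nonempty: "s \<le> t \<Longrightarrow> partitions s t \<noteq> {}"
  using interval_partition[of s t] singleton_partition[of s t] by fastforce

text \<open>
  For comparing partition sums over \<open>[s,t]\<close> with those over \<open>[s,u]\<close> and \<open>[u,t]\<close>: at most one step has to
  be estimated by hand, all others are shared.
\<close>

lemma partition_split:
  assumes "ts \<in> partitions s t" "s \<le> u" "u \<le> t"
  obtains (point) ts1 ts2 where "ts1 \<in> partitions s u" "ts2 \<in> partitions u t"
      "steps ts = steps ts1 @ steps ts2"
  | (broken) v w ts1 ts2 where "v < u" "u < w" "ts1 \<in> partitions s v" "ts2 \<in> partitions w t"
      "steps ts = steps ts1 @ (v, w) # steps ts2"
proof -
  have "(\<exists>ts1\<in>partitions s u. \<exists>ts2\<in>partitions u t. steps ts = steps ts1 @ steps ts2) \<or>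
    (\<exists>v w. v < u \<and> u < w \<and> (\<exists>ts1\<in>partitions s v. \<exists>ts2\<in>partitions w t.
       steps ts = steps ts1 @ (v, w) # steps ts2))"
    using assms
  proof (induction rule: partition_induct)
    case (single s)
    then have "[s] \<in> partitions s u" "[s] \<in> partitions u t" "steps [s] = steps [s] @ steps [s]"
      by auto
    then show ?case by blast
  next
    case (step s v l)
    note whole = step.hyps
    consider "u = s" | "s < u" "u < v" | "v \<le> u" using step.prems by linarith
    then show ?case
    proof cases
      case 1
      then have "[s] \<in> partitions s u" "s # v # l \<in> partitions u t"
        using whole by (auto simp: partition_Cons)
      moreover have "steps (s # v # l) = steps [s] @ steps (s # v # l)" by simp
      ultimately show ?thesis by blast
    next
      case 2
      then have "s < u \<and> u < v \<and> (\<exists>ts1\<in>partitions s s. \<exists>ts2\<in>partitions v t.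
          steps (s # v # l) = steps ts1 @ (s, v) # steps ts2)"
        using whole by (intro conjI bexI[of _ "[s]"] bexI[of _ "v # l"]) auto
      then show ?thesis by blast
    next
      case 3
      have ext: "\<exists>ts1'\<in>partitions s r. steps ts1' = (s, v) # steps ts1"
        if "ts1 \<in> partitions v r" for ts1 r
        using partition_append[OF interval_partition[OF whole(1)] that] by fastforce
      from step.IH 3 step.prems(2) consider
        (a) ts1 ts2 where "ts1 \<in> partitions v u" "ts2 \<in> partitions u t"
          "steps (v # l) = steps ts1 @ steps ts2"
      | (b) v' w ts1 ts2 where "v' < u" "u < w" "ts1 \<in> partitions v v'" "ts2 \<in> partitions w t"
          "steps (v # l) = steps ts1 @ (v', w) # steps ts2"
        by blast
      then show ?thesis
      proof cases
        case a
        with ext[OF a(1)] show ?thesis by (intro disjI1) (metis append_Cons steps_simps(3))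
      next
        case b
        with ext[OF b(3)] show ?thesis by (intro disjI2) (metis append_Cons steps_simps(3))
      qed
    qed
  qed
  then show ?thesis using point broken by blast
qed

lemma fine_partition_exists:
  assumes "s \<le> t" "\<delta> > 0"
  obtains ts where "ts \<in> partitions s t" "\<And>u v. (u, v) \<in> set (steps ts) \<Longrightarrow> v - u < \<delta>"
proof -
  have "\<exists>ts\<in>partitions s t. \<forall>(u, v)\<in>set (steps ts). v - u < \<delta>"
    if "t - s \<le> real n * (\<delta> / 2)" "s \<le> t" for n s
    using that
  proof (induction n arbitrary: s)
    case 0
    then have "[s] \<in> partitions s t" by simp
    then show ?case by (auto intro!: bexI[of _ "[s]"])
  next
    case (Suc n)
    show ?case
    proof (cases "t - s < \<delta>")
      case True
      show ?thesis
      proof (cases "s = t")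
        case True
        then show ?thesis by (intro bexI[of _ "[s]"]) auto
      next
        case False
        with True Suc.prems show ?thesis by (intro bexI[of _ "[s, t]"]) (auto simp: partition_Cons)
      qed
    next
      case False
      with Suc.prems assms have "t - (s + \<delta> / 2) \<le> real n * (\<delta> / 2)" "s + \<delta> / 2 \<le> t"
        by (auto simp: algebra_simps)
      from Suc.IH[OF this] obtain ts where ts: "ts \<in> partitions (s + \<delta> / 2) t"
        "\<forall>(u, v)\<in>set (steps ts). v - u < \<delta>" by blast
      have "[s, s + \<delta> / 2] \<in> partitions s (s + \<delta> / 2)"
        using assms by (intro interval_partition) simp
      from partition_append[OF this ts(1)] obtain ts' where
        "ts' \<in> partitions s t" "steps ts' = (s, s + \<delta> / 2) # steps ts" by auto
      with ts(2) assms show ?thesis by (auto intro!: bexI[of _ ts'])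
    qed
  qed
  moreover obtain n where "(t - s) / (\<delta> / 2) \<le> real n" using real_arch_simple by blast
  then have "t - s \<le> real n * (\<delta> / 2)" using assms by (simp add: field_simps)
  ultimately show ?thesis using assms(1) that by blast
qed

section \<open>Two inequalities for powers\<close>

lemma powr_convex_nonneg:
  fixes x y r \<theta> :: real
  assumes "1 \<le> r" "0 \<le> x" "0 \<le> y" "0 < \<theta>" "\<theta> < 1"
  shows "(\<theta> * x + (1 - \<theta>) * y) powr r \<le> \<theta> * x powr r + (1 - \<theta>) * y powr r"
proof -
  have le: "c powr r \<le> c" if "0 < c" "c < 1" for c :: real
    using powr_mono'[of 1 r c] that assms by simp
  have zero: "(c * z) powr r \<le> c * z powr r" if "0 < c" "c < 1" "0 \<le> z" for c z :: real
    using mult_right_mono[OF le[OF that(1,2)], of "z powr r"] that by (simp add: powr_mult)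
  consider "x = 0" | "y = 0" | "0 < x" "0 < y" using assms by linarith
  then show ?thesis
  proof cases
    case 3
    then show ?thesis
      using convex_onD[OF powr_convex[OF assms(1)], of "1 - \<theta>" x y] assms by simp
  qed (use zero[of \<theta> x] zero[of "1 - \<theta>" y] assms in simp_all)
qed

text \<open>By convexity, increments of the power function grow with the base point.\<close>

lemma powr_increment_mono:
  fixes a A c r :: real
  assumes "1 \<le> r" "0 \<le> a" "a \<le> A" "0 \<le> c"
  shows "(a + c) powr r - a powr r \<le> (A + c) powr r - A powr r"
proof (rule DERIV_nonneg_imp_increasing_open[OF assms(3)])
  fix z assume z: "a < z" "z < A"
  have "((\<lambda>z. (z + c) powr r - z powr r) has_real_derivative
      r * (z + c) powr (r - 1) - r * z powr (r - 1)) (at z)"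
    using z assms by (auto intro!: derivative_eq_intros)
  moreover have "r * z powr (r - 1) \<le> r * (z + c) powr (r - 1)"
    using z assms by (intro mult_left_mono powr_mono2) auto
  ultimately show "\<exists>D. ((\<lambda>z. (z + c) powr r - z powr r) has_real_derivative D) (at z) \<and> 0 \<le> D"
    by (auto intro!: exI)
next
  show "continuous_on {a..A} (\<lambda>z. (z + c) powr r - z powr r)"
    using assms by (intro continuous_intros continuous_on_powr') auto
qed

section \<open>Bounds on the variation of two-parameter functions\<close>

text \<open>
  An upper bound for the variation norm instead of the norm itself: since a real supremum is
  meaningful only for bounded families, this lets inequalities between variation norms be chained
  through real-valued \<open>\<phi>\<close> without a finiteness condition for each intermediate function.
\<close>

definition var_le ::
  "real \<Rightarrow> real \<Rightarrow> real \<Rightarrow> (real \<Rightarrow> real \<Rightarrow> real) \<Rightarrow> real \<Rightarrow> bool" where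
  "var_le r s t \<phi> A \<longleftrightarrow>
     0 \<le> A \<and> (\<forall>ts\<in>partitions s t. (\<Sum>(u, v)\<leftarrow>steps ts. \<phi> u v powr r) \<le> A powr r)"

lemma var_leI:
  assumes "0 \<le> A"
    and "\<And>ts. ts \<in> partitions s t \<Longrightarrow> (\<Sum>(u, v)\<leftarrow>steps ts. \<phi> u v powr r) \<le> A powr r"
  shows "var_le r s t \<phi> A"
  using assms by (auto simp: var_le_def)

lemma var_leD:
  assumes "var_le r s t \<phi> A"
  shows "0 \<le> A"
    and "ts \<in> partitions s t \<Longrightarrow> (\<Sum>(u, v)\<leftarrow>steps ts. \<phi> u v powr r) \<le> A powr r"
  using assms by (auto simp: var_le_def)

lemma sum_steps_mono:
  fixes F G :: "real \<Rightarrow> real \<Rightarrow> real"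
  assumes "ts \<in> partitions s t" "\<And>u v. s \<le> u \<Longrightarrow> u < v \<Longrightarrow> v \<le> t \<Longrightarrow> F u v \<le> G u v"
  shows "(\<Sum>(u, v)\<leftarrow>steps ts. F u v) \<le> (\<Sum>(u, v)\<leftarrow>steps ts. G u v)"
  using partition_steps_bounds[OF assms(1)] assms(2) by (intro sum_list_mono) force

lemma sum_steps_nonneg:
  fixes F :: "real \<Rightarrow> real \<Rightarrow> real"
  assumes "\<And>u v. 0 \<le> F u v"
  shows "0 \<le> (\<Sum>(u, v)\<leftarrow>steps ts. F u v)"
  using assms by (intro sum_list_nonneg) auto

lemma sum_steps_add:
  fixes F G :: "real \<Rightarrow> real \<Rightarrow> 'b::comm_monoid_add"
  shows "(\<Sum>(u, v)\<leftarrow>l. F u v + G u v) = (\<Sum>(u, v)\<leftarrow>l. F u v) + (\<Sum>(u, v)\<leftarrow>l. G u v)"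
  by (induction l) (auto simp: algebra_simps)

lemma sum_steps_scale:
  fixes F :: "real \<Rightarrow> real \<Rightarrow> real"
  shows "(\<Sum>(u, v)\<leftarrow>l. c * F u v) = c * (\<Sum>(u, v)\<leftarrow>l. F u v)"
  by (induction l) (auto simp: algebra_simps)

lemma powr_le_powr_iff:
  fixes a b r :: real
  assumes "0 < r" "0 \<le> a" "0 \<le> b"
  shows "a powr r \<le> b powr r \<longleftrightarrow> a \<le> b"
  using assms powr_less_mono2[of r b a] powr_mono2[of r a b] by fastforce

lemma powr_powr_inverse:
  fixes A r :: real
  assumes "0 < r" "0 \<le> A"
  shows "(A powr r) powr (1 / r) = A" "(A powr (1 / r)) powr r = A"
  using assms by (simp_all add: powr_powr)

lemma pvar2_le:
  assumes "0 < r" "s \<le> t" "var_le r s t (\<lambda>u v. norm (R u v)) A"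
  shows "pvar2 r s t R \<le> A"
proof -
  have "(SUP ts\<in>partitions s t. \<Sum>(u, v)\<leftarrow>steps ts. norm (R u v) powr r) \<le> A powr r"
    using var_leD(2)[OF assms(3)] partitions_nonempty[OF assms(2)] by (intro cSUP_least) auto
  moreover have "0 \<le> (SUP ts\<in>partitions s t. \<Sum>(u, v)\<leftarrow>steps ts. norm (R u v) powr r)"
  proof -
    obtain ts where ts: "ts \<in> partitions s t" using partitions_nonempty[OF assms(2)] by blast
    have "0 \<le> (\<Sum>(u, v)\<leftarrow>steps ts. norm (R u v) powr r)" by (intro sum_steps_nonneg) simp
    also have "\<dots> \<le> (SUP ts\<in>partitions s t. \<Sum>(u, v)\<leftarrow>steps ts. norm (R u v) powr r)"
      using ts var_leD(2)[OF assms(3)] by (intro cSUP_upper bdd_aboveI2) auto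
    finally show ?thesis .
  qed
  ultimately have "pvar2 r s t R \<le> (A powr r) powr (1 / r)"
    unfolding pvar2_def using assms(1) by (intro powr_mono2) auto
  then show ?thesis using powr_powr_inverse assms(1) var_leD(1)[OF assms(3)] by simp
qed

lemma pvar2_powr_le:
  assumes "0 < r" "s \<le> t"
    and "\<And>ts. ts \<in> partitions s t \<Longrightarrow> (\<Sum>(u, v)\<leftarrow>steps ts. norm (R u v) powr r) \<le> M"
  shows "pvar2 r s t R powr r \<le> M"
proof -
  obtain ts where "ts \<in> partitions s t" using partitions_nonempty[OF assms(2)] by blast
  with assms(3) have M: "0 \<le> M"
    using sum_steps_nonneg[of "\<lambda>u v. norm (R u v) powr r" ts] by force
  then have "var_le r s t (\<lambda>u v. norm (R u v)) (M powr (1 / r))"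
    using assms by (intro var_leI) (auto simp: powr_powr)
  then have "pvar2 r s t R powr r \<le> (M powr (1 / r)) powr r"
    using pvar2_le[OF assms(1,2)] assms(1) by (intro powr_mono2) (auto simp: pvar2_def)
  then show ?thesis using M assms(1) by (simp add: powr_powr)
qed

lemma pvar2_nonneg [simp]: "0 \<le> pvar2 r s t R"
  by (simp add: pvar2_def)

lemma pvar_nonneg [simp]: "0 \<le> pvar r s t y"
  by (simp add: pvar_def)

definition finite_var :: "real \<Rightarrow> real \<Rightarrow> real \<Rightarrow> (real \<Rightarrow> real \<Rightarrow> 'a::real_normed_vector) \<Rightarrow> bool" where
  "finite_var r s t R \<longleftrightarrow> (\<exists>A. var_le r s t (\<lambda>u v. norm (R u v)) A)"

lemma var_le_pvar2:
  assumes "0 < r" "finite_var r s t R"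
  shows "var_le r s t (\<lambda>u v. norm (R u v)) (pvar2 r s t R)"
proof (rule var_leI)
  fix ts assume ts: "ts \<in> partitions s t"
  obtain A where A: "var_le r s t (\<lambda>u v. norm (R u v)) A"
    using assms(2) by (auto simp: finite_var_def)
  let ?V = "SUP ts\<in>partitions s t. \<Sum>(u, v)\<leftarrow>steps ts. norm (R u v) powr r"
  have "0 \<le> (\<Sum>(u, v)\<leftarrow>steps ts. norm (R u v) powr r)" by (intro sum_steps_nonneg) simp
  also have le: "\<dots> \<le> ?V"
    using ts var_leD(2)[OF A] by (intro cSUP_upper bdd_aboveI2) auto
  finally have "?V = pvar2 r s t R powr r"
    using assms(1) by (simp add: pvar2_def powr_powr)
  with le show "(\<Sum>(u, v)\<leftarrow>steps ts. norm (R u v) powr r) \<le> pvar2 r s t R powr r" by simp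
qed simp

lemma var_le_subinterval:
  assumes "var_le r s t \<phi> A" "s \<le> s'" "s' \<le> t'" "t' \<le> t"
  shows "var_le r s' t' \<phi> A"
proof (rule var_leI)
  fix ts assume ts: "ts \<in> partitions s' t'"
  obtain l where l: "l \<in> partitions s s'" using partitions_nonempty[OF assms(2)] by blast
  obtain k where k: "k \<in> partitions t' t" using partitions_nonempty[OF assms(4)] by blast
  obtain ts0 where ts0: "ts0 \<in> partitions s' t" "steps ts0 = steps ts @ steps k"
    using partition_append[OF ts k] .
  obtain ts' where "ts' \<in> partitions s t" "steps ts' = steps l @ steps ts0"
    using partition_append[OF l ts0(1)] .
  with ts0 have ts': "ts' \<in> partitions s t" "steps ts' = steps l @ steps ts @ steps k" by simp_all
  have "(\<Sum>(u, v)\<leftarrow>steps ts. \<phi> u v powr r) \<le> (\<Sum>(u, v)\<leftarrow>steps ts'. \<phi> u v powr r)"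
    using sum_steps_nonneg[of "\<lambda>u v. \<phi> u v powr r" l] sum_steps_nonneg[of "\<lambda>u v. \<phi> u v powr r" k]
    by (simp add: ts'(2))
  also have "\<dots> \<le> A powr r" using var_leD(2)[OF assms(1) ts'(1)] .
  finally show "(\<Sum>(u, v)\<leftarrow>steps ts. \<phi> u v powr r) \<le> A powr r" .
qed (use var_leD(1)[OF assms(1)] in simp)

lemma finite_var_subinterval:
  assumes "finite_var r s t R" "s \<le> s'" "s' \<le> t'" "t' \<le> t"
  shows "finite_var r s' t' R"
  using assms(1) var_le_subinterval[OF _ assms(2-4)] by (auto simp: finite_var_def)

lemma pvar2_mono:
  assumes "0 < r" "finite_var r s t R" "s \<le> s'" "s' \<le> t'" "t' \<le> t"
  shows "pvar2 r s' t' R \<le> pvar2 r s t R"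
  using var_le_subinterval[OF var_le_pvar2[OF assms(1,2)] assms(3-5)] assms by (intro pvar2_le) auto

lemma norm_le_pvar2:
  assumes "0 < r" "finite_var r s t R" "s \<le> u" "u < v" "v \<le> t"
  shows "norm (R u v) \<le> pvar2 r s t R"
proof -
  have "var_le r u v (\<lambda>u v. norm (R u v)) (pvar2 r s t R)"
    using assms by (intro var_le_subinterval[OF var_le_pvar2]) auto
  from var_leD(2)[OF this interval_partition] assms show ?thesis
    by (auto simp: powr_le_powr_iff)
qed

text \<open>
  Partitions of the two halves concatenate to a partition of the whole interval, so the \<open>r\<close>-th power
  of the variation is a control in the sense of Lyons.
\<close>

lemma pvar2_superadditive:
  assumes "0 < r" "finite_var r s t R" "s \<le> u" "u \<le> t"
  shows "pvar2 r s u R powr r + pvar2 r u t R powr r \<le> pvar2 r s t R powr r"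
proof -
  let ?P = "\<lambda>ts. \<Sum>(u, v)\<leftarrow>steps ts. norm (R u v) powr r"
  have fin: "finite_var r s u R" "finite_var r u t R"
    using assms by (auto intro: finite_var_subinterval)
  have "?P ts2 \<le> pvar2 r s t R powr r - pvar2 r s u R powr r" if ts2: "ts2 \<in> partitions u t" for ts2
  proof -
    have "pvar2 r s u R powr r \<le> pvar2 r s t R powr r - ?P ts2"
    proof (rule pvar2_powr_le[OF assms(1,3)])
      fix ts1 assume ts1: "ts1 \<in> partitions s u"
      obtain ts where "ts \<in> partitions s t" "steps ts = steps ts1 @ steps ts2"
        using partition_append[OF ts1 ts2] by blast
      then show "?P ts1 \<le> pvar2 r s t R powr r - ?P ts2"
        using var_leD(2)[OF var_le_pvar2[OF assms(1,2)], of ts] by simp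
    qed
    then show ?thesis by simp
  qed
  then have "pvar2 r u t R powr r \<le> pvar2 r s t R powr r - pvar2 r s u R powr r"
    by (intro pvar2_powr_le[OF assms(1,4)])
  then show ?thesis by simp
qed

lemma sum_steps_superadditive:
  fixes W :: "real \<Rightarrow> real \<Rightarrow> real"
  assumes "ts \<in> partitions s t" "\<And>u v. 0 \<le> W u v"
    and "\<And>u v w. s \<le> u \<Longrightarrow> u \<le> v \<Longrightarrow> v \<le> w \<Longrightarrow> w \<le> t \<Longrightarrow> W u v + W v w \<le> W u w"
  shows "(\<Sum>(u, v)\<leftarrow>steps ts. W u v) \<le> W s t"
  using assms
proof (induction rule: partition_induct)
  case (step s v l)
  then have "(\<Sum>(u, v)\<leftarrow>steps (v # l). W u v) \<le> W v t" by auto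
  moreover have "W s v + W v t \<le> W s t"
    using step.hyps by (intro step.prems) (auto dest: partition_le)
  ultimately show ?case by simp
qed simp

lemma var_le_superadditive:
  fixes W :: "real \<Rightarrow> real \<Rightarrow> real"
  assumes "0 < r" "\<And>u v. 0 \<le> W u v" "0 \<le> W s t"
    and "\<And>u v w. s \<le> u \<Longrightarrow> u \<le> v \<Longrightarrow> v \<le> w \<Longrightarrow> w \<le> t \<Longrightarrow>
      W u v powr r + W v w powr r \<le> W u w powr r"
  shows "var_le r s t W (W s t)"
  using assms by (intro var_leI sum_steps_superadditive[where W = "\<lambda>u v. W u v powr r"]) auto

text \<open>
  This makes the sewing error, a product of variation norms over the current step, summable over
  the steps of a partition.
\<close>

lemma var_le_interval_pvar2:
  assumes "0 < r" "finite_var r s t R"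
  shows "var_le r s t (\<lambda>u v. pvar2 r u v R) (pvar2 r s t R)"
proof (rule var_le_superadditive)
  fix u v w assume "s \<le> u" "u \<le> v" "v \<le> w" "w \<le> t"
  then show "pvar2 r u v R powr r + pvar2 r v w R powr r \<le> pvar2 r u w R powr r"
    using assms by (intro pvar2_superadditive finite_var_subinterval[OF assms(2)]) auto
qed (use assms in auto)

lemma var_le_mono:
  assumes "var_le r s t \<psi> A" "0 < r"
    and "\<And>u v. s \<le> u \<Longrightarrow> u < v \<Longrightarrow> v \<le> t \<Longrightarrow> 0 \<le> \<phi> u v \<and> \<phi> u v \<le> \<psi> u v"
  shows "var_le r s t \<phi> A"
proof (rule var_leI)
  fix ts assume ts: "ts \<in> partitions s t"
  have "(\<Sum>(u, v)\<leftarrow>steps ts. \<phi> u v powr r) \<le> (\<Sum>(u, v)\<leftarrow>steps ts. \<psi> u v powr r)"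
    using assms by (intro sum_steps_mono[OF ts] powr_mono2) auto
  also have "\<dots> \<le> A powr r" using var_leD(2)[OF assms(1) ts] .
  finally show "(\<Sum>(u, v)\<leftarrow>steps ts. \<phi> u v powr r) \<le> A powr r" .
qed (use var_leD[OF assms(1)] in simp)

lemma var_le_scale:
  assumes "var_le r s t \<phi> A" "0 \<le> c" "\<And>u v. s \<le> u \<Longrightarrow> u < v \<Longrightarrow> v \<le> t \<Longrightarrow> 0 \<le> \<phi> u v"
  shows "var_le r s t (\<lambda>u v. c * \<phi> u v) (c * A)"
proof (rule var_leI)
  fix ts assume ts: "ts \<in> partitions s t"
  have "(\<Sum>(u, v)\<leftarrow>steps ts. (c * \<phi> u v) powr r) \<le> (\<Sum>(u, v)\<leftarrow>steps ts. c powr r * \<phi> u v powr r)"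
    using assms by (intro sum_steps_mono[OF ts]) (auto simp: powr_mult)
  also have "\<dots> \<le> c powr r * A powr r"
    using var_leD(2)[OF assms(1) ts] by (simp add: sum_steps_scale mult_left_mono)
  also have "\<dots> = (c * A) powr r" using assms(2) var_leD(1)[OF assms(1)] by (simp add: powr_mult)
  finally show "(\<Sum>(u, v)\<leftarrow>steps ts. (c * \<phi> u v) powr r) \<le> (c * A) powr r" .
qed (use var_leD[OF assms(1)] assms(2) in simp)

lemma var_le_bound:
  assumes "var_le r s t \<phi> A" "0 < r" "s \<le> u" "u < v" "v \<le> t" "0 \<le> \<phi> u v"
  shows "\<phi> u v \<le> A"
proof -
  have "var_le r u v \<phi> A" using assms by (intro var_le_subinterval[OF assms(1)]) auto
  from var_leD[OF this] interval_partition[OF assms(4)] have "\<phi> u v powr r \<le> A powr r" "0 \<le> A"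
    by fastforce+
  then show ?thesis using assms by (simp add: powr_le_powr_iff)
qed

text \<open>
  Minkowski's inequality.  Normalising both sequences by their bounds turns it into the convexity
  inequality with weights \<open>A / (A + B)\<close> and \<open>B / (A + B)\<close>, applied in every step.
\<close>

lemma var_le_add:
  assumes "1 \<le> r" "var_le r s t \<phi> A" "var_le r s t \<psi> B"
    and "\<And>u v. s \<le> u \<Longrightarrow> u < v \<Longrightarrow> v \<le> t \<Longrightarrow> 0 \<le> \<phi> u v \<and> 0 \<le> \<psi> u v"
  shows "var_le r s t (\<lambda>u v. \<phi> u v + \<psi> u v) (A + B)"
proof -
  note nonneg = var_leD(1)[OF assms(2)] var_leD(1)[OF assms(3)]
  consider "A = 0" | "B = 0" | "0 < A" "0 < B" using nonneg by linarith
  then show ?thesis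
  proof cases
    case 1
    show ?thesis unfolding 1 add_0_left
      using assms var_le_bound[OF assms(2)] 1 by (intro var_le_mono[OF assms(3)]) force+
  next
    case 2
    show ?thesis unfolding 2 add_0_right
      using assms var_le_bound[OF assms(3)] 2 by (intro var_le_mono[OF assms(2)]) force+
  next
    case 3
    define \<theta> where "\<theta> = A / (A + B)"
    have \<theta>: "0 < \<theta>" "\<theta> < 1" "1 - \<theta> = B / (A + B)" using 3 by (auto simp: \<theta>_def field_simps)
    let ?cA = "(A + B) powr r * \<theta> / A powr r" and ?cB = "(A + B) powr r * (1 - \<theta>) / B powr r"
    show ?thesis
    proof (rule var_leI)
      fix ts assume ts: "ts \<in> partitions s t"
      have "(\<phi> u v + \<psi> u v) powr r \<le> ?cA * \<phi> u v powr r + ?cB * \<psi> u v powr r"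
        if uv: "s \<le> u" "u < v" "v \<le> t" for u v
      proof -
        have weights: "(A + B) * \<theta> = A" "(A + B) * (1 - \<theta>) = B"
          unfolding \<theta>(3) by (use 3 in \<open>simp_all add: \<theta>_def\<close>)
        have "(A + B) * (\<theta> * (\<phi> u v / A) + (1 - \<theta>) * (\<psi> u v / B))
            = (A + B) * \<theta> * (\<phi> u v / A) + (A + B) * (1 - \<theta>) * (\<psi> u v / B)"
          by (simp only: distrib_left mult.assoc)
        also have "\<dots> = \<phi> u v + \<psi> u v" unfolding weights using 3 by simp
        finally have "(A + B) * (\<theta> * (\<phi> u v / A) + (1 - \<theta>) * (\<psi> u v / B)) = \<phi> u v + \<psi> u v" .
        then have "(\<phi> u v + \<psi> u v) powr r
            = ((A + B) * (\<theta> * (\<phi> u v / A) + (1 - \<theta>) * (\<psi> u v / B))) powr r"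
          by (simp only:)
        also have "\<dots> = (A + B) powr r * (\<theta> * (\<phi> u v / A) + (1 - \<theta>) * (\<psi> u v / B)) powr r"
          by (rule powr_mult)
        also have "\<dots> \<le> (A + B) powr r * (\<theta> * (\<phi> u v / A) powr r + (1 - \<theta>) * (\<psi> u v / B) powr r)"
          using 3 \<theta> assms(1) assms(4)[OF uv] by (intro mult_left_mono powr_convex_nonneg) auto
        also have "\<dots> = ?cA * \<phi> u v powr r + ?cB * \<psi> u v powr r"
          using 3 assms(4)[OF uv] by (simp add: powr_divide algebra_simps)
        finally show ?thesis .
      qed
      then have "(\<Sum>(u, v)\<leftarrow>steps ts. (\<phi> u v + \<psi> u v) powr r)
          \<le> (\<Sum>(u, v)\<leftarrow>steps ts. ?cA * \<phi> u v powr r + ?cB * \<psi> u v powr r)"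
        by (rule sum_steps_mono[OF ts])
      also have "\<dots> = ?cA * (\<Sum>(u, v)\<leftarrow>steps ts. \<phi> u v powr r) + ?cB * (\<Sum>(u, v)\<leftarrow>steps ts. \<psi> u v powr r)"
        by (simp only: sum_steps_add sum_steps_scale)
      also have "\<dots> \<le> ?cA * A powr r + ?cB * B powr r"
        using var_leD(2)[OF assms(2) ts] var_leD(2)[OF assms(3) ts] 3 \<theta>
        by (intro add_mono mult_left_mono) auto
      also have "\<dots> = (A + B) powr r" using 3 by (simp add: field_simps)
      finally show "(\<Sum>(u, v)\<leftarrow>steps ts. (\<phi> u v + \<psi> u v) powr r) \<le> (A + B) powr r" .
    qed (use nonneg in simp)
  qed
qed

text \<open>Each single term satisfies \<open>\<phi> \<le> A\<close>, hence \<open>\<phi>\<^bsup>r'\<^esup> \<le> A\<^bsup>r' - r\<^esup> \<phi>\<^bsup>r\<^esup>\<close>.\<close>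

lemma var_le_exponent_mono:
  assumes "0 < r" "r \<le> r'" "var_le r s t \<phi> A"
    and nonneg: "\<And>u v. s \<le> u \<Longrightarrow> u < v \<Longrightarrow> v \<le> t \<Longrightarrow> 0 \<le> \<phi> u v"
  shows "var_le r' s t \<phi> A"
proof (rule var_leI)
  fix ts assume ts: "ts \<in> partitions s t"
  have "(\<Sum>(u, v)\<leftarrow>steps ts. \<phi> u v powr r') \<le> (\<Sum>(u, v)\<leftarrow>steps ts. A powr (r' - r) * \<phi> u v powr r)"
  proof (rule sum_steps_mono[OF ts])
    fix u v assume uv: "s \<le> u" "u < v" "v \<le> t"
    have "\<phi> u v powr r' = \<phi> u v powr (r' - r) * \<phi> u v powr r" by (simp flip: powr_add)
    also have "\<dots> \<le> A powr (r' - r) * \<phi> u v powr r"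
      using var_le_bound[OF assms(3,1) uv] nonneg[OF uv] assms by (intro mult_right_mono powr_mono2) auto
    finally show "\<phi> u v powr r' \<le> A powr (r' - r) * \<phi> u v powr r" .
  qed
  also have "\<dots> = A powr (r' - r) * (\<Sum>(u, v)\<leftarrow>steps ts. \<phi> u v powr r)" by (simp only: sum_steps_scale)
  also have "\<dots> \<le> A powr (r' - r) * A powr r"
    using var_leD(2)[OF assms(3) ts] by (intro mult_left_mono) auto
  also have "\<dots> = A powr r'" by (simp flip: powr_add)
  finally show "(\<Sum>(u, v)\<leftarrow>steps ts. \<phi> u v powr r') \<le> A powr r'" .
qed (use var_leD[OF assms(3)] in simp)

lemma var_le_square:
  assumes "var_le p s t \<phi> A" "\<And>u v. s \<le> u \<Longrightarrow> u < v \<Longrightarrow> v \<le> t \<Longrightarrow> 0 \<le> \<phi> u v"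
  shows "var_le (p / 2) s t (\<lambda>u v. (\<phi> u v)\<^sup>2) (A\<^sup>2)"
proof (rule var_leI)
  have half: "(z\<^sup>2) powr (p / 2) = z powr p" if "0 \<le> z" for z :: real
  proof (cases "z = 0")
    case False
    then have "z\<^sup>2 = z powr 2" using that by simp
    then show ?thesis by (simp only: powr_powr) simp
  qed simp
  fix ts assume ts: "ts \<in> partitions s t"
  have "(\<Sum>(u, v)\<leftarrow>steps ts. ((\<phi> u v)\<^sup>2) powr (p / 2)) \<le> (\<Sum>(u, v)\<leftarrow>steps ts. \<phi> u v powr p)"
    using assms(2) half by (intro sum_steps_mono[OF ts]) auto
  also have "\<dots> \<le> A\<^sup>2 powr (p / 2)" using var_leD[OF assms(1)] ts half by simp
  finally show "(\<Sum>(u, v)\<leftarrow>steps ts. ((\<phi> u v)\<^sup>2) powr (p / 2)) \<le> A\<^sup>2 powr (p / 2)" .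
qed simp

text \<open>
  Cutting a step of a partition at \<open>u\<close> changes the partition sum; that the \<open>r\<close>-variation norm is
  nevertheless subadditive under concatenation, with constant one, is Minkowski's inequality for
  two sequences that overlap only in the broken step.  For a remainder, which is not additive, the
  failure of the triangle inequality is measured by \<open>\<kappa>\<close>, and it enters only once because only one
  step is broken.
\<close>

lemma pvar2_concat:
  assumes "1 \<le> r" "finite_var r s t R" "s \<le> u" "u \<le> t" "0 \<le> \<kappa>"
    and cut: "\<And>v w. s \<le> v \<Longrightarrow> v < u \<Longrightarrow> u < w \<Longrightarrow> w \<le> t \<Longrightarrow>
      norm (R v w) \<le> norm (R v u) + norm (R u w) + \<kappa>"
  shows "pvar2 r s t R \<le> pvar2 r s u R + pvar2 r u t R + \<kappa>"
proof (rule pvar2_le)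
  let ?P = "\<lambda>ts. \<Sum>(u, v)\<leftarrow>steps ts. norm (R u v) powr r"
  define A B where "A = pvar2 r s u R" and "B = pvar2 r u t R"
  have fin: "finite_var r s u R" "finite_var r u t R"
    using assms by (auto intro: finite_var_subinterval)
  have r: "0 < r" and AB: "0 \<le> A" "0 \<le> B" using assms(1) by (auto simp: A_def B_def)
  note left = var_leD(2)[OF var_le_pvar2[OF r fin(1)], folded A_def]
    and right = var_leD(2)[OF var_le_pvar2[OF r fin(2)], folded B_def]
  have "var_le r s t (\<lambda>u v. norm (R u v)) (A + B + \<kappa>)"
  proof (rule var_leI)
    fix ts assume "ts \<in> partitions s t"
    then show "?P ts \<le> (A + B + \<kappa>) powr r"
    proof (rule partition_split[OF _ assms(3,4)])
      fix ts1 ts2 assume ts: "ts1 \<in> partitions s u" "ts2 \<in> partitions u t"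
        "steps ts = steps ts1 @ steps ts2"
      have "?P ts \<le> A powr r + B powr r" using left[OF ts(1)] right[OF ts(2)] ts(3) by simp
      also have "\<dots> \<le> (A + B) powr r"
        using powr_increment_mono[of r 0 A B] AB assms(1) by simp
      also have "\<dots> \<le> (A + B + \<kappa>) powr r" using AB assms by (intro powr_mono2) auto
      finally show ?thesis .
    next
      fix v w ts1 ts2 assume ts: "v < u" "u < w" "ts1 \<in> partitions s v" "ts2 \<in> partitions w t"
        "steps ts = steps ts1 @ (v, w) # steps ts2"
      define a b where "a = norm (R v u)" and "b = norm (R u w)"
      obtain ts1' where "ts1' \<in> partitions s u" "steps ts1' = steps ts1 @ [(v, u)]"
        using partition_append[OF ts(3) interval_partition[OF ts(1)]] by auto
      then have 1: "?P ts1 + a powr r \<le> A powr r" using left[of ts1'] by (simp add: a_def)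
      obtain ts2' where "ts2' \<in> partitions u t" "steps ts2' = (u, w) # steps ts2"
        using partition_append[OF interval_partition[OF ts(2)] ts(4)] by auto
      then have 2: "?P ts2 + b powr r \<le> B powr r" using right[of ts2'] by (simp add: b_def)
      have "0 \<le> ?P ts1" "0 \<le> ?P ts2" by (auto intro!: sum_steps_nonneg)
      with 1 2 have "a powr r \<le> A powr r" "b powr r \<le> B powr r" by auto
      then have ab: "0 \<le> a" "a \<le> A" "0 \<le> b" "b \<le> B"
        using AB r by (auto simp: a_def b_def powr_le_powr_iff)
      have "norm (R v w) powr r \<le> (a + b + \<kappa>) powr r"
        unfolding a_def b_def
        using ts assms r partition_le[OF ts(3)] partition_le[OF ts(4)]
        by (intro powr_mono2 cut) auto
      then have "?P ts \<le> ?P ts1 + ?P ts2 + (a + b + \<kappa>) powr r" by (simp add: ts(5))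
      also have "\<dots> \<le> (A + B + \<kappa>) powr r"
        using 1 2 powr_increment_mono[of r a A "b + \<kappa>"] powr_increment_mono[of r b B "A + \<kappa>"]
          ab assms by (simp add: add_ac)
      finally show ?thesis .
    qed
  qed (use AB assms in simp)
  then show "var_le r s t (\<lambda>u v. norm (R u v)) (pvar2 r s u R + pvar2 r u t R + \<kappa>)"
    by (simp add: A_def B_def)
qed (use assms in auto)

section \<open>Hoelder regularity and variation\<close>

lemma hoelder_continuous:
  assumes "hoelder \<beta> I y" "0 < \<beta>"
  shows "continuous_on I y"
proof -
  obtain K where K: "\<And>s t. s \<in> I \<Longrightarrow> t \<in> I \<Longrightarrow> norm (y t - y s) \<le> K * \<bar>t - s\<bar> powr \<beta>"
    using assms(1) by (auto simp: hoelder_def)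
  show ?thesis unfolding continuous_on
  proof
    fix s assume s: "s \<in> I"
    have "((\<lambda>t. K * \<bar>t - s\<bar> powr \<beta>) \<longlongrightarrow> K * \<bar>s - s\<bar> powr \<beta>) (at s within I)"
      using assms(2) by (intro tendsto_intros) auto
    then have "((\<lambda>t. K * \<bar>t - s\<bar> powr \<beta>) \<longlongrightarrow> 0) (at s within I)" by simp
    then have "((\<lambda>t. y t - y s) \<longlongrightarrow> 0) (at s within I)"
      by (rule Lim_null_comparison[rotated]) (auto simp: eventually_at_filter K s)
    then show "(y \<longlongrightarrow> y s) (at s within I)" by (rule Lim_null[THEN iffD2])
  qed
qed

lemma hoelder_increments:
  assumes "hoelder \<beta> I y" "0 < \<beta>"
  shows "hoelder2 \<beta> I (\<lambda>u v. y v - y u)"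
proof -
  have cont: "continuous_on I y" by (rule hoelder_continuous[OF assms])
  have "continuous_on (I \<times> I) (\<lambda>z. y (snd z) - y (fst z))"
    by (intro continuous_intros continuous_on_compose2[OF cont]) auto
  then show ?thesis using assms(1)
    unfolding hoelder2_def hoelder_def case_prod_beta by fastforce
qed

lemma hoelder2_linear_bound:
  assumes "hoelder2 \<beta> {a..b} R" "0 < r" "1 \<le> \<beta> * r"
  obtains C where "0 \<le> C"
    "\<And>u v. a \<le> u \<Longrightarrow> u < v \<Longrightarrow> v \<le> b \<Longrightarrow> norm (R u v) powr r \<le> C * (v - u)"
proof -
  obtain K where K: "\<And>u v. a \<le> u \<Longrightarrow> u < v \<Longrightarrow> v \<le> b \<Longrightarrow> norm (R u v) \<le> K * (v - u) powr \<beta>"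
    using assms(1) by (force simp: hoelder2_def)
  define C where "C = \<bar>K\<bar> powr r * (b - a) powr (\<beta> * r - 1)"
  have "norm (R u v) powr r \<le> C * (v - u)" if uv: "a \<le> u" "u < v" "v \<le> b" for u v
  proof -
    have "K * (v - u) powr \<beta> \<le> \<bar>K\<bar> * (v - u) powr \<beta>" by (intro mult_right_mono) auto
    with K[OF uv] have "norm (R u v) powr r \<le> (\<bar>K\<bar> * (v - u) powr \<beta>) powr r"
      using assms(2) by (intro powr_mono2) auto
    also have "\<dots> = \<bar>K\<bar> powr r * ((v - u) powr (\<beta> * r - 1) * (v - u))"
      using uv by (simp add: powr_mult powr_powr powr_diff)
    also have "\<dots> \<le> \<bar>K\<bar> powr r * ((b - a) powr (\<beta> * r - 1) * (v - u))"
      using uv assms(3) by (intro mult_left_mono mult_right_mono powr_mono2) auto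
    finally show ?thesis by (simp add: C_def mult.assoc)
  qed
  then show ?thesis using that[of C] by (simp add: C_def)
qed

lemma linear_bound_sum_steps:
  assumes "ts \<in> partitions s t"
    and "\<And>u v. s \<le> u \<Longrightarrow> u < v \<Longrightarrow> v \<le> t \<Longrightarrow> \<phi> u v \<le> C * (v - u)"
  shows "(\<Sum>(u, v)\<leftarrow>steps ts. \<phi> u v) \<le> C * (t - s)"
  using assms
proof (induction rule: partition_induct)
  case (step s v l)
  then have "(\<Sum>(u, v)\<leftarrow>steps (v # l). \<phi> u v) \<le> C * (t - v)" "\<phi> s v \<le> C * (v - s)"
    by (auto dest: partition_le)
  then show ?case by (simp add: algebra_simps)
qed simp

lemma linear_bound_finite_var:
  assumes "0 < r" "s \<le> t" "0 \<le> C"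
    and "\<And>u v. s \<le> u \<Longrightarrow> u < v \<Longrightarrow> v \<le> t \<Longrightarrow> norm (R u v) powr r \<le> C * (v - u)"
  shows "finite_var r s t R" and "pvar2 r s t R powr r \<le> C * (t - s)"
proof -
  note le = linear_bound_sum_steps[where \<phi> = "\<lambda>u v. norm (R u v) powr r", OF _ assms(4)]
  have "var_le r s t (\<lambda>u v. norm (R u v)) ((C * (t - s)) powr (1 / r))"
    using le assms(1-3) by (intro var_leI) (auto simp: powr_powr)
  then show "finite_var r s t R" by (auto simp: finite_var_def)
  show "pvar2 r s t R powr r \<le> C * (t - s)" using le assms(1,2) by (intro pvar2_powr_le) auto
qed

lemma hoelder2_finite_var:
  assumes "hoelder2 \<beta> {a..b} R" "0 < r" "1 \<le> \<beta> * r" "a \<le> b"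
  shows "finite_var r a b R"
proof -
  obtain C where "0 \<le> C"
    "\<And>u v. a \<le> u \<Longrightarrow> u < v \<Longrightarrow> v \<le> b \<Longrightarrow> norm (R u v) powr r \<le> C * (v - u)"
    using hoelder2_linear_bound[OF assms(1-3)] by blast
  then show ?thesis using assms by (intro linear_bound_finite_var(1)[of r a b C])
qed

text \<open>
  Shrinking the interval from \<open>[s,t']\<close> to \<open>[s,t]\<close> breaks one step \<open>(v,w)\<close> of a partition; by uniform
  continuity its contribution is close to that of \<open>(v,t)\<close>, and what is cut off lies in \<open>[t,t']\<close>,
  where the variation is at most linear in the length.
\<close>

lemma pvar2_powr_continuous:
  assumes "hoelder2 \<beta> {a..b} R" "0 < r" "1 \<le> \<beta> * r" "a \<le> s"
  shows "continuous_on {s..b} (\<lambda>t. pvar2 r s t R powr r)"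
proof -
  obtain C where C: "0 \<le> C"
    "\<And>u v. a \<le> u \<Longrightarrow> u < v \<Longrightarrow> v \<le> b \<Longrightarrow> norm (R u v) powr r \<le> C * (v - u)"
    using hoelder2_linear_bound[OF assms(1-3)] by blast
  let ?P = "\<lambda>ts. \<Sum>(u, v)\<leftarrow>steps ts. norm (R u v) powr r"
  let ?V = "\<lambda>t. pvar2 r s t R powr r"
  have fin: "finite_var r s t R" if "s \<le> t" "t \<le> b" for t
    using that assms C by (intro linear_bound_finite_var(1)[of r s t C]) auto
  have P_le: "?P ts \<le> ?V t" if "ts \<in> partitions s t" "t \<le> b" for ts t
    using var_leD(2)[OF var_le_pvar2[OF assms(2) fin]] that partition_le by blast
  have P_lin: "?P ts \<le> C * (t - u)" if "ts \<in> partitions u t" "s \<le> u" "t \<le> b" for ts u t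
    using that assms C by (intro linear_bound_sum_steps) auto
  have "continuous_on ({a..b} \<times> {a..b}) (\<lambda>z. norm (R (fst z) (snd z)) powr r)"
    using assms(1,2) by (intro continuous_on_powr' continuous_on_norm continuous_on_const)
      (auto simp: hoelder2_def case_prod_beta)
  then have unif: "uniformly_continuous_on ({a..b} \<times> {a..b}) (\<lambda>z. norm (R (fst z) (snd z)) powr r)"
    by (rule compact_uniformly_continuous) (intro compact_Times compact_Icc)
  show ?thesis unfolding continuous_on_iff
  proof (intro ballI allI impI)
    fix t0 \<epsilon> :: real assume t0: "t0 \<in> {s..b}" and \<epsilon>: "0 < \<epsilon>"
    obtain \<delta>1 where \<delta>1: "0 < \<delta>1" "\<And>z z'. z \<in> {a..b} \<times> {a..b} \<Longrightarrow> z' \<in> {a..b} \<times> {a..b} \<Longrightarrow>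
        dist z' z < \<delta>1 \<Longrightarrow>
        dist (norm (R (fst z') (snd z')) powr r) (norm (R (fst z) (snd z)) powr r) < \<epsilon> / 3"
      using unif[unfolded uniformly_continuous_on_def, rule_format, of "\<epsilon> / 3"] \<epsilon> by auto
    \<comment> \<open>One third of \<open>\<epsilon>\<close> pays for the change of the broken step, one for the variation on \<open>[t,t']\<close>.\<close>
    define \<delta> where "\<delta> = min \<delta>1 (\<epsilon> / (3 * (C + 1)))"
    have \<delta>: "0 < \<delta>" using \<delta>1(1) \<epsilon> C(1) by (simp add: \<delta>_def)
    have small: "C * d \<le> \<epsilon> / 3" if "0 \<le> d" "d < \<delta>" for d
    proof -
      have "d * (3 * (C + 1)) \<le> \<epsilon>" using that C(1) by (simp add: \<delta>_def pos_less_divide_eq)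
      then have "C * d * 3 + 3 * d \<le> \<epsilon>" by (simp add: algebra_simps)
      then show ?thesis using that(1) by simp
    qed
    have step: "?V t' \<le> ?V t + 2 * \<epsilon> / 3" if t: "s \<le> t" "t \<le> t'" "t' \<le> b" "t' - t < \<delta>" for t t'
    proof (rule pvar2_powr_le[OF assms(2)])
      fix ts assume "ts \<in> partitions s t'"
      then show "?P ts \<le> ?V t + 2 * \<epsilon> / 3"
      proof (rule partition_split[OF _ t(1,2)])
        fix ts1 ts2 assume ts: "ts1 \<in> partitions s t" "ts2 \<in> partitions t t'"
          "steps ts = steps ts1 @ steps ts2"
        then have "?P ts \<le> ?V t + C * (t' - t)" using P_le[OF ts(1)] P_lin[OF ts(2)] t by simp
        with small[of "t' - t"] t \<epsilon> show ?thesis by simp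
      next
        fix v w ts1 ts2 assume ts: "v < t" "t < w" "ts1 \<in> partitions s v" "ts2 \<in> partitions w t'"
          "steps ts = steps ts1 @ (v, w) # steps ts2"
        have order: "s \<le> v" "w \<le> t'" using ts(3,4) by (auto dest: partition_le)
        have "dist (v, w) (v, t) < \<delta>1"
          using ts t order by (simp add: dist_Pair_Pair dist_real_def \<delta>_def)
        moreover have "(v, t) \<in> {a..b} \<times> {a..b}" "(v, w) \<in> {a..b} \<times> {a..b}"
          using ts t order assms by auto
        ultimately have "\<bar>norm (R v w) powr r - norm (R v t) powr r\<bar> < \<epsilon> / 3"
          using \<delta>1(2)[of "(v, t)" "(v, w)"] by (simp add: dist_real_def)
        then have "norm (R v w) powr r \<le> norm (R v t) powr r + \<epsilon> / 3" by linarith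
        moreover obtain ts1' where "ts1' \<in> partitions s t" "steps ts1' = steps ts1 @ [(v, t)]"
          using partition_append[OF ts(3) interval_partition[OF ts(1)]] by auto
        then have "?P ts1 + norm (R v t) powr r \<le> ?V t" using P_le[of ts1' t] t by simp
        moreover have "?P ts2 \<le> C * (t' - w)" using P_lin[OF ts(4)] ts t by simp
        moreover have "C * (t' - w) \<le> \<epsilon> / 3" using small[of "t' - w"] ts t order by simp
        ultimately show ?thesis by (simp add: ts(5))
      qed
    qed (use t in simp)
    have mono: "?V t \<le> ?V t'" if "s \<le> t" "t \<le> t'" "t' \<le> b" for t t'
      using that assms fin by (intro powr_mono2 pvar2_mono) auto
    have "dist (?V t) (?V t0) < \<epsilon>" if "t \<in> {s..b}" "dist t t0 < \<delta>" for t
    proof (cases "t \<le> t0")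
      case True
      then show ?thesis using that t0 \<epsilon> step[of t t0] mono[of t t0] by (auto simp: dist_real_def)
    next
      case False
      then show ?thesis using that t0 \<epsilon> step[of t0 t] mono[of t0 t] by (auto simp: dist_real_def)
    qed
    with \<delta> show "\<exists>d>0. \<forall>t\<in>{s..b}. dist t t0 < d \<longrightarrow> dist (?V t) (?V t0) < \<epsilon>" by blast
  qed
qed

section \<open>Rough path norms and greedy times\<close>

lemma rp_pvar_nonneg [simp]: "0 \<le> rp_pvar p s t x X"
  by (simp add: rp_pvar_def)

lemma rp_pvar_powr:
  "0 < p \<Longrightarrow> rp_pvar p s t x X powr p = pvar p s t x powr p + pvar2 (p / 2) s t X powr (p / 2)"
  by (simp add: rp_pvar_def powr_powr)

lemma pvar_le_rp_pvar:
  assumes "0 < p"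
  shows "pvar p s t x \<le> rp_pvar p s t x X"
proof -
  have "pvar p s t x powr p \<le> rp_pvar p s t x X powr p" by (simp add: rp_pvar_powr assms)
  then show ?thesis using assms by (simp add: powr_le_powr_iff)
qed

lemma pvar2_le_rp_pvar_square:
  assumes "0 < p"
  shows "pvar2 (p / 2) s t X \<le> (rp_pvar p s t x X)\<^sup>2"
proof -
  have "((rp_pvar p s t x X)\<^sup>2) powr (p / 2) = rp_pvar p s t x X powr p"
  proof (cases "rp_pvar p s t x X = 0")
    case False
    then have "(rp_pvar p s t x X)\<^sup>2 = rp_pvar p s t x X powr 2"
      using rp_pvar_nonneg[of p s t x X] by simp
    then show ?thesis by (simp only: powr_powr) simp
  qed simp
  then have "pvar2 (p / 2) s t X powr (p / 2) \<le> ((rp_pvar p s t x X)\<^sup>2) powr (p / 2)"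
    by (simp add: rp_pvar_powr assms)
  then show ?thesis using assms by (simp add: powr_le_powr_iff)
qed

locale rough_path_variation =
  fixes T :: "'v::real_normed_vector \<Rightarrow> 'v \<Rightarrow> 't::real_normed_vector"
    and x :: "real \<Rightarrow> 'v" and X :: "real \<Rightarrow> real \<Rightarrow> 't" and \<nu> p a b :: real
  assumes rough_path: "rough_path \<nu> T a b x X"
    and exponent: "0 < \<nu>" "1 \<le> \<nu> * p" "0 < p"
    and nontrivial: "a < b"
begin

lemma hoelder2_x: "hoelder2 \<nu> {a..b} (\<lambda>u v. x v - x u)"
  using rough_path exponent by (auto simp: rough_path_def intro: hoelder_increments)

lemma hoelder2_X: "hoelder2 (2 * \<nu>) {a..b} X"
  using rough_path by (simp add: rough_path_def)

lemma finite_var_x: "finite_var p a b (\<lambda>u v. x v - x u)"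
  using hoelder2_finite_var[OF hoelder2_x] exponent nontrivial by simp

lemma finite_var_X: "finite_var (p / 2) a b X"
  using hoelder2_finite_var[OF hoelder2_X] exponent nontrivial by simp

lemma rp_pvar_linear:
  obtains C where "0 \<le> C"
    "\<And>s t. a \<le> s \<Longrightarrow> s \<le> t \<Longrightarrow> t \<le> b \<Longrightarrow> rp_pvar p s t x X powr p \<le> C * (t - s)"
proof -
  obtain C where C: "0 \<le> C"
    "\<And>u v. a \<le> u \<Longrightarrow> u < v \<Longrightarrow> v \<le> b \<Longrightarrow> norm (x v - x u) powr p \<le> C * (v - u)"
    using hoelder2_linear_bound[OF hoelder2_x] exponent by auto
  obtain D where D: "0 \<le> D"
    "\<And>u v. a \<le> u \<Longrightarrow> u < v \<Longrightarrow> v \<le> b \<Longrightarrow> norm (X u v) powr (p / 2) \<le> D * (v - u)"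
    using hoelder2_linear_bound[OF hoelder2_X, of "p / 2"] exponent by auto
  have "rp_pvar p s t x X powr p \<le> (C + D) * (t - s)" if st: "a \<le> s" "s \<le> t" "t \<le> b" for s t
  proof -
    have "pvar p s t x powr p \<le> C * (t - s)" unfolding pvar_def
      using C st exponent by (intro linear_bound_finite_var(2)) auto
    moreover have "pvar2 (p / 2) s t X powr (p / 2) \<le> D * (t - s)"
      using D st exponent by (intro linear_bound_finite_var(2)) auto
    ultimately show ?thesis using exponent by (simp add: rp_pvar_powr algebra_simps)
  qed
  then show ?thesis using that[of "C + D"] C D by simp
qed

lemma rp_pvar_self:
  assumes "a \<le> s" "s \<le> b"
  shows "rp_pvar p s s x X = 0"
proof -
  obtain C where "0 \<le> C"
    and C: "\<And>s t. a \<le> s \<Longrightarrow> s \<le> t \<Longrightarrow> t \<le> b \<Longrightarrow> rp_pvar p s t x X powr p \<le> C * (t - s)"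
    using rp_pvar_linear by blast
  show ?thesis using C[OF assms(1) order_refl assms(2)] by simp
qed

lemma rp_pvar_continuous:
  assumes "a \<le> s"
  shows "continuous_on {s..b} (\<lambda>t. rp_pvar p s t x X)"
proof -
  have "continuous_on {s..b} (\<lambda>t. pvar2 p s t (\<lambda>u v. x v - x u) powr p)"
    "continuous_on {s..b} (\<lambda>t. pvar2 (p / 2) s t X powr (p / 2))"
    using pvar2_powr_continuous[OF hoelder2_x] pvar2_powr_continuous[OF hoelder2_X, of "p / 2"]
      assms exponent by auto
  then show ?thesis unfolding rp_pvar_def pvar_def
    using exponent by (intro continuous_on_powr'[OF continuous_on_add continuous_on_const]) auto
qed

text \<open>
  By continuity of the norm in the right end point the level \<open>\<gamma>\<close> cannot be jumped over, and the
  infimum in the definition of the greedy times is attained.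
\<close>

lemma greedy_step:
  assumes \<tau>: "a \<le> \<tau>" "\<tau> \<le> b" and \<gamma>: "0 < \<gamma>"
    and S: "S = {t. \<tau> < t \<and> t \<le> b \<and> rp_pvar p \<tau> t x X = \<gamma>}"
    and \<sigma>: "\<sigma> = (if S = {} then b else min (Inf S) b)"
  shows "\<tau> \<le> \<sigma>" "\<sigma> \<le> b" "rp_pvar p \<tau> \<sigma> x X \<le> \<gamma>" "\<sigma> = b \<or> rp_pvar p \<tau> \<sigma> x X = \<gamma>"
proof -
  note cont = rp_pvar_continuous[OF \<tau>(1)]
  have "\<tau> \<le> \<sigma> \<and> \<sigma> \<le> b \<and> rp_pvar p \<tau> \<sigma> x X \<le> \<gamma> \<and> (\<sigma> = b \<or> rp_pvar p \<tau> \<sigma> x X = \<gamma>)"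
  proof (cases "S = {}")
    case True
    have "rp_pvar p \<tau> b x X \<le> \<gamma>"
    proof (rule ccontr)
      assume "\<not> ?thesis"
      then obtain t where "\<tau> \<le> t" "t \<le> b" "rp_pvar p \<tau> t x X = \<gamma>"
        using IVT'[of "\<lambda>t. rp_pvar p \<tau> t x X" \<tau> \<gamma> b] cont \<tau> \<gamma> rp_pvar_self[OF \<tau>] by auto
      moreover from this have "t \<noteq> \<tau>" using rp_pvar_self[OF \<tau>] \<gamma> by auto
      ultimately show False using True S by auto
    qed
    then show ?thesis using True \<sigma> \<tau> by simp
  next
    case False
    \<comment> \<open>\<open>\<tau>\<close> itself is excluded from \<open>S\<close> automatically because the norm vanishes there, so \<open>S\<close> is closed.\<close>
    have S': "S = {\<tau>..b} \<inter> (\<lambda>t. rp_pvar p \<tau> t x X) -` {\<gamma>}"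
      using rp_pvar_self[OF \<tau>] \<gamma> by (auto simp: S order_less_le)
    have "closed S" unfolding S' using cont by (intro continuous_closed_preimage) auto
    moreover have "bdd_below S" unfolding S by (auto intro!: bdd_belowI[of _ \<tau>])
    ultimately have "Inf S \<in> S" using False closed_contains_Inf by blast
    then show ?thesis using \<sigma> False by (auto simp: S min_def)
  qed
  then show "\<tau> \<le> \<sigma>" "\<sigma> \<le> b" "rp_pvar p \<tau> \<sigma> x X \<le> \<gamma>" "\<sigma> = b \<or> rp_pvar p \<tau> \<sigma> x X = \<gamma>"
    by blast+
qed

lemma greedy_time_bounds:
  assumes "0 < \<gamma>"
  shows "a \<le> greedy_time \<gamma> p a b x X i \<and> greedy_time \<gamma> p a b x X i \<le> b"
proof (induction i)
  case (Suc i)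
  then show ?case
    using greedy_step(1,2)[OF conjunct1[OF Suc] conjunct2[OF Suc] assms refl refl]
    by (simp add: Let_def)
qed (use nontrivial in simp)

lemma greedy_time_step:
  fixes i
  assumes "0 < \<gamma>"
  defines "\<tau> \<equiv> greedy_time \<gamma> p a b x X"
  shows "\<tau> i \<le> \<tau> (Suc i)" "rp_pvar p (\<tau> i) (\<tau> (Suc i)) x X \<le> \<gamma>"
    "\<tau> (Suc i) = b \<or> rp_pvar p (\<tau> i) (\<tau> (Suc i)) x X = \<gamma>"
proof -
  have "a \<le> \<tau> i" "\<tau> i \<le> b" using greedy_time_bounds[OF assms(1)] by (simp_all add: \<tau>_def)
  moreover have "\<tau> (Suc i) = (if {t. \<tau> i < t \<and> t \<le> b \<and> rp_pvar p (\<tau> i) t x X = \<gamma>} = {} then b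
      else min (Inf {t. \<tau> i < t \<and> t \<le> b \<and> rp_pvar p (\<tau> i) t x X = \<gamma>}) b)"
    by (simp only: \<tau>_def greedy_time.simps Let_def)
  ultimately show "\<tau> i \<le> \<tau> (Suc i)" "rp_pvar p (\<tau> i) (\<tau> (Suc i)) x X \<le> \<gamma>"
    "\<tau> (Suc i) = b \<or> rp_pvar p (\<tau> i) (\<tau> (Suc i)) x X = \<gamma>"
    using greedy_step[OF _ _ assms(1) refl] by blast+
qed

text \<open>
  On a complete greedy interval the \<open>p\<close>-th power of the rough path norm is \<open>\<gamma>\<^sup>p\<close> and at most a multiple
  of the length; the lengths are thus bounded below and there are only finitely many intervals.
\<close>

lemma greedy_count_attained:
  assumes "0 < \<gamma>"
  shows "greedy_time \<gamma> p a b x X (greedy_count \<gamma> p a b x X) = b"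
proof -
  let ?\<tau> = "greedy_time \<gamma> p a b x X"
  obtain C where C: "0 \<le> C"
    "\<And>s t. a \<le> s \<Longrightarrow> s \<le> t \<Longrightarrow> t \<le> b \<Longrightarrow> rp_pvar p s t x X powr p \<le> C * (t - s)"
    using rp_pvar_linear by blast
  have "\<exists>i. ?\<tau> i = b"
  proof (rule ccontr)
    assume never: "\<not> (\<exists>i. ?\<tau> i = b)"
    have "real i * \<gamma> powr p \<le> C * (?\<tau> i - a)" for i
    proof (induction i)
      case (Suc i)
      have "rp_pvar p (?\<tau> i) (?\<tau> (Suc i)) x X = \<gamma>"
        using greedy_time_step(3)[OF assms, of i] never by blast
      then have "\<gamma> powr p \<le> C * (?\<tau> (Suc i) - ?\<tau> i)"
        using C(2)[of "?\<tau> i" "?\<tau> (Suc i)"] greedy_time_bounds[OF assms]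
          greedy_time_step(1)[OF assms, of i] by (simp del: greedy_time.simps(2))
      with Suc have "real (Suc i) * \<gamma> powr p \<le> C * (?\<tau> i - a) + C * (?\<tau> (Suc i) - ?\<tau> i)"
        by (simp add: algebra_simps del: greedy_time.simps(2))
      then show ?case by (simp only: right_diff_distrib)
    qed simp
    moreover have "C * (?\<tau> i - a) \<le> C * (b - a)" for i
      using C(1) greedy_time_bounds[OF assms, of i] by (intro mult_left_mono) auto
    ultimately have "real i * \<gamma> powr p \<le> C * (b - a)" for i by (meson order_trans)
    moreover obtain i where "C * (b - a) / \<gamma> powr p < real i" using reals_Archimedean2 by blast
    then have "C * (b - a) < real i * \<gamma> powr p" using assms by (simp add: field_simps)
    ultimately show False by (meson not_less)
  qed
  then show ?thesis unfolding greedy_count_def by (rule LeastI_ex)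
qed

end

section \<open>Additivity of the rough integral\<close>

lemma has_rough_integral_diff:
  assumes as: "has_rough_integral T x X Y Y' a s J" and at: "has_rough_integral T x X Y Y' a t K"
    and "a \<le> s"
  shows "has_rough_integral T x X Y Y' s t (K - J)"
  unfolding has_rough_integral_def
proof (intro allI impI)
  fix \<epsilon> :: real assume "0 < \<epsilon>"
  then have \<epsilon>: "0 < \<epsilon> / 2" by simp
  let ?\<Sigma> = "\<lambda>ts. \<Sum>(u, v)\<leftarrow>steps ts. Y u (x v - x u) + tensor_apply T (Y' u) (X u v)"
  obtain \<delta>1 where \<delta>1: "0 < \<delta>1" "\<And>ts. ts \<in> partitions a s \<Longrightarrow>
      \<forall>(u, v)\<in>set (steps ts). v - u < \<delta>1 \<Longrightarrow> norm (?\<Sigma> ts - J) < \<epsilon> / 2"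
    using as \<epsilon> unfolding has_rough_integral_def by blast
  obtain \<delta>2 where \<delta>2: "0 < \<delta>2" "\<And>ts. ts \<in> partitions a t \<Longrightarrow>
      \<forall>(u, v)\<in>set (steps ts). v - u < \<delta>2 \<Longrightarrow> norm (?\<Sigma> ts - K) < \<epsilon> / 2"
    using at \<epsilon> unfolding has_rough_integral_def by blast
  have "norm (?\<Sigma> ts - (K - J)) < \<epsilon>"
    if ts: "ts \<in> partitions s t" "\<forall>(u, v)\<in>set (steps ts). v - u < \<delta>2" for ts
  proof -
    \<comment> \<open>Prolonged by a sufficiently fine partition of \<open>[a,s]\<close>, \<open>ts\<close> becomes a fine partition of \<open>[a,t]\<close>.\<close>
    obtain l where l: "l \<in> partitions a s" "\<And>u v. (u, v) \<in> set (steps l) \<Longrightarrow> v - u < min \<delta>1 \<delta>2"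
      using fine_partition_exists[OF assms(3), of "min \<delta>1 \<delta>2"] \<delta>1(1) \<delta>2(1) by auto
    obtain k where k: "k \<in> partitions a t" "steps k = steps l @ steps ts"
      using partition_append[OF l(1) ts(1)] .
    have "norm (?\<Sigma> l - J) < \<epsilon> / 2" using l by (intro \<delta>1(2)) fastforce+
    moreover have "norm (?\<Sigma> k - K) < \<epsilon> / 2" using l ts k by (intro \<delta>2(2)) fastforce+
    moreover have "norm (?\<Sigma> ts - (K - J)) \<le> norm (?\<Sigma> k - K) + norm (?\<Sigma> l - J)"
      using norm_triangle_ineq4[of "?\<Sigma> k - K" "?\<Sigma> l - J"] by (simp add: k(2) algebra_simps)
    ultimately show ?thesis by linarith
  qed
  with \<delta>2(1) show "\<exists>\<delta>>0. \<forall>ts\<in>partitions s t. (\<forall>(u, v)\<in>set (steps ts). v - u < \<delta>) \<longrightarrow>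
      norm (?\<Sigma> ts - (K - J)) < \<epsilon>" by blast
qed

section \<open>Gronwall's inequality\<close>

lemma gronwall_integral:
  fixes m :: "real \<Rightarrow> real"
  assumes "s \<le> t" "continuous_on {s..t} m" "0 \<le> k"
    and le: "\<And>u. s \<le> u \<Longrightarrow> u \<le> t \<Longrightarrow> m u \<le> c + k * integral {s..u} m"
  shows "c + k * integral {s..t} m \<le> c * exp (k * (t - s))"
proof -
  let ?H = "\<lambda>u. (c + k * integral {s..u} m) * exp (- (k * (u - s)))"
  have "?H t \<le> ?H s"
  proof (rule DERIV_nonpos_imp_decreasing_open[OF assms(1)])
    fix u assume u: "s < u" "u < t"
    have "((\<lambda>u. integral {s..u} m) has_real_derivative m u) (at u)"
      using integral_has_real_derivative[OF assms(2), of u] u by (simp add: at_within_Icc_at)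
    then have "(?H has_real_derivative
        k * (m u - (c + k * integral {s..u} m)) * exp (- (k * (u - s)))) (at u)"
      by (auto intro!: derivative_eq_intros simp: algebra_simps)
    moreover have "k * (m u - (c + k * integral {s..u} m)) * exp (- (k * (u - s))) \<le> 0"
      using le[of u] u assms(3) by (intro mult_nonpos_nonneg mult_nonneg_nonpos) auto
    ultimately show "\<exists>D. (?H has_real_derivative D) (at u) \<and> D \<le> 0" by blast
  next
    show "continuous_on {s..t} ?H"
      using assms(2) by (intro continuous_intros indefinite_integral_continuous_1 integrable_continuous_interval)
  qed
  then have "(c + k * integral {s..t} m) / exp (k * (t - s)) \<le> c"
    by (simp add: exp_minus divide_inverse)
  then show ?thesis by (simp add: pos_divide_le_eq)
qed

section \<open>Composing controlled paths with a vector field\<close>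

lemma hoelder_exponent_mono:
  assumes "hoelder \<beta> {a..b} y" "\<alpha> \<le> \<beta>"
  shows "hoelder \<alpha> {a..b} y"
proof -
  obtain K where K: "\<And>s t. s \<in> {a..b} \<Longrightarrow> t \<in> {a..b} \<Longrightarrow> norm (y t - y s) \<le> K * \<bar>t - s\<bar> powr \<beta>"
    using assms(1) unfolding hoelder_def by blast
  have "norm (y t - y s) \<le> (\<bar>K\<bar> * (b - a) powr (\<beta> - \<alpha>)) * \<bar>t - s\<bar> powr \<alpha>"
    if st: "s \<in> {a..b}" "t \<in> {a..b}" for s t
  proof -
    have "norm (y t - y s) \<le> \<bar>K\<bar> * \<bar>t - s\<bar> powr \<beta>"
      using K[OF st] mult_right_mono[OF abs_ge_self[of K], of "\<bar>t - s\<bar> powr \<beta>"] by simp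
    also have "\<bar>t - s\<bar> powr \<beta> = \<bar>t - s\<bar> powr (\<beta> - \<alpha>) * \<bar>t - s\<bar> powr \<alpha>" by (simp flip: powr_add)
    also have "\<dots> \<le> (b - a) powr (\<beta> - \<alpha>) * \<bar>t - s\<bar> powr \<alpha>"
      using st assms(2) by (intro mult_right_mono powr_mono2) auto
    finally show ?thesis by (simp add: mult.assoc mult_left_mono)
  qed
  then show ?thesis unfolding hoelder_def by blast
qed

lemma hoelder_lipschitz:
  assumes "hoelder \<beta> I y" "0 \<le> L"
    and "\<And>s t. s \<in> I \<Longrightarrow> t \<in> I \<Longrightarrow> norm (z t - z s) \<le> L * norm (y t - y s)"
  shows "hoelder \<beta> I z"
proof -
  obtain K where K: "\<And>s t. s \<in> I \<Longrightarrow> t \<in> I \<Longrightarrow> norm (y t - y s) \<le> K * \<bar>t - s\<bar> powr \<beta>"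
    using assms(1) unfolding hoelder_def by blast
  have "norm (z t - z s) \<le> (L * K) * \<bar>t - s\<bar> powr \<beta>" if "s \<in> I" "t \<in> I" for s t
    using assms(3)[OF that] mult_left_mono[OF K[OF that] assms(2)] by (simp add: mult.assoc)
  then show ?thesis by (auto simp: hoelder_def)
qed

locale bounded_vector_field =
  fixes g :: "'d::real_normed_vector \<Rightarrow> 'm::real_normed_vector \<Rightarrow>\<^sub>L 'd"
    and g1 :: "'d \<Rightarrow> 'd \<Rightarrow>\<^sub>L 'm \<Rightarrow>\<^sub>L 'd" and C :: real
  assumes g_derivative: "(g has_derivative g1 z) (at z)"
    and g_bound: "norm (g z) \<le> C"
    and g1_bound: "norm (g1 z) \<le> C"
    and g1_lipschitz: "norm (g1 z' - g1 z) \<le> C * norm (z' - z)"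
begin

lemma C_nonneg: "0 \<le> C"
  using g_bound[of 0] norm_ge_zero order_trans by blast

lemma g_lipschitz: "norm (g z' - g z) \<le> C * norm (z' - z)"
proof (rule differentiable_bound[where S = UNIV and f' = g1])
  fix w show "(g has_derivative g1 w) (at w within UNIV)" using g_derivative by simp
  show "onorm (g1 w) \<le> C" using g1_bound[of w] by (simp add: norm_blinfun.rep_eq)
qed auto

lemma g_taylor: "norm (g (z + h) - g z - g1 z h) \<le> C * (norm h)\<^sup>2"
proof -
  have "norm (g (z + h) - g z - g1 z (z + h - z)) \<le> norm (z + h - z) * (C * norm h)"
  proof (rule differentiable_bound_linearization[where S = "(\<lambda>t. z + t *\<^sub>R h) ` {0..1}"])
    fix w assume "w \<in> (\<lambda>t. z + t *\<^sub>R h) ` {0..1}"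
    then obtain t where t: "t \<in> {0..1}" "w = z + t *\<^sub>R h" by blast
    show "(g has_derivative g1 w) (at w within (\<lambda>t. z + t *\<^sub>R h) ` {0..1})"
      using g_derivative has_derivative_at_withinI by blast
    have "onorm (blinfun_apply (g1 w) - blinfun_apply (g1 z)) = norm (g1 w - g1 z)"
      by (simp add: norm_blinfun.rep_eq minus_blinfun.rep_eq fun_diff_def)
    also have "\<dots> \<le> C * (t * norm h)" using g1_lipschitz[of w z] t by simp
    also have "\<dots> \<le> C * norm h"
      using C_nonneg t by (intro mult_left_mono mult_left_le_one_le) auto
    finally show "onorm (blinfun_apply (g1 w) - blinfun_apply (g1 z)) \<le> C * norm h" .
  next
    show "z \<in> (\<lambda>t. z + t *\<^sub>R h) ` {0..1}" by (rule image_eqI[of _ _ 0]) auto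
  qed auto
  then show ?thesis by (simp add: power2_eq_square ac_simps)
qed

lemma g1g_lipschitz: "norm ((g1 z' o\<^sub>L g z') - (g1 z o\<^sub>L g z)) \<le> 2 * C\<^sup>2 * norm (z' - z)"
proof -
  have "(g1 z' o\<^sub>L g z') - (g1 z o\<^sub>L g z) = ((g1 z' - g1 z) o\<^sub>L g z') + (g1 z o\<^sub>L (g z' - g z))"
    by (simp add: bounded_bilinear.diff_left[OF bounded_bilinear_blinfun_compose]
        bounded_bilinear.diff_right[OF bounded_bilinear_blinfun_compose])
  also have "norm \<dots> \<le> norm (g1 z' - g1 z) * norm (g z') + norm (g1 z) * norm (g z' - g z)"
    by (intro norm_triangle_mono norm_blinfun_compose)
  also have "\<dots> \<le> (C * norm (z' - z)) * C + C * (C * norm (z' - z))"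
    using C_nonneg g_bound g1_bound g_lipschitz g1_lipschitz
    by (intro add_mono mult_mono) auto
  also have "\<dots> = 2 * C\<^sup>2 * norm (z' - z)" by (simp add: power2_eq_square)
  finally show ?thesis .
qed

lemma g1g_bound: "norm (g1 z o\<^sub>L g z) \<le> C\<^sup>2"
  using norm_blinfun_compose[of "g1 z" "g z"] mult_mono[OF g1_bound g_bound, of z z] C_nonneg
  by (simp add: power2_eq_square)

text \<open>
  The natural Taylor expansion around \<open>y\<^sub>s\<close> would produce a term quadratic in \<open>y\<close>, which does not close
  to a linear estimate.  Expanding instead around the first-order increment \<open>h = g(y\<^sub>s) x\<^sub>s\<^sub>t\<close> leaves
  \<open>R\<^sup>y\<close>, on which only the Lipschitz bound is used, and the quadratic term \<open>h\<^sup>2\<close>, in which the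
  boundedness of \<open>g\<close> replaces \<open>y\<close> by \<open>x\<close>.
\<close>

lemma remainder_compose_bound:
  "norm (remainder x (\<lambda>t. g (y t)) (\<lambda>t. g1 (y t) o\<^sub>L g (y t)) s t)
     \<le> C * norm (remainder x y (\<lambda>t. g (y t)) s t) + C ^ 3 * (norm (x t - x s))\<^sup>2"
proof -
  let ?h = "g (y s) (x t - x s)"
  have y: "y t = y s + ?h + remainder x y (\<lambda>t. g (y t)) s t" by (simp add: remainder_def)
  have "norm (remainder x (\<lambda>t. g (y t)) (\<lambda>t. g1 (y t) o\<^sub>L g (y t)) s t)
      = norm ((g (y t) - g (y s + ?h)) + (g (y s + ?h) - g (y s) - g1 (y s) ?h))"
    by (simp add: remainder_def algebra_simps)
  also have "\<dots> \<le> C * norm (remainder x y (\<lambda>t. g (y t)) s t) + C * (norm ?h)\<^sup>2"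
    using g_lipschitz[of "y t" "y s + ?h"] y by (intro norm_triangle_mono g_taylor) simp
  also have "norm ?h \<le> C * norm (x t - x s)"
    using norm_blinfun[of "g (y s)" "x t - x s"] mult_right_mono[OF g_bound[of "y s"]]
    by (meson norm_ge_zero order_trans)
  then have "C * (norm ?h)\<^sup>2 \<le> C * (C * norm (x t - x s))\<^sup>2"
    using C_nonneg by (intro mult_left_mono power_mono) auto
  finally show ?thesis by (simp add: power_mult_distrib power2_eq_square power3_eq_cube ac_simps)
qed

lemma controlled_path_compose:
  assumes y: "controlled_path \<alpha> x a b y (\<lambda>t. g (y t))" and x: "hoelder \<alpha> {a..b} x" and "0 < \<alpha>"
  shows "controlled_path \<alpha> x a b (\<lambda>t. g (y t)) (\<lambda>t. g1 (y t) o\<^sub>L g (y t))"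
proof -
  have hy: "hoelder \<alpha> {a..b} y" and hR: "hoelder2 (2 * \<alpha>) {a..b} (remainder x y (\<lambda>t. g (y t)))"
    using y by (auto simp: controlled_path_def)
  have hg: "hoelder \<alpha> {a..b} (\<lambda>t. g (y t))"
    by (rule hoelder_lipschitz[OF hy C_nonneg g_lipschitz])
  have hg1: "hoelder \<alpha> {a..b} (\<lambda>t. g1 (y t) o\<^sub>L g (y t))"
    by (rule hoelder_lipschitz[OF hy _ g1g_lipschitz]) simp
  note cont = continuous_on_compose2[OF hoelder_continuous[OF hg \<open>0 < \<alpha>\<close>]]
    continuous_on_compose2[OF hoelder_continuous[OF hg1 \<open>0 < \<alpha>\<close>]]
    continuous_on_compose2[OF hoelder_continuous[OF x \<open>0 < \<alpha>\<close>]]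
  let ?RY = "remainder x (\<lambda>t. g (y t)) (\<lambda>t. g1 (y t) o\<^sub>L g (y t))"
  have "continuous_on ({a..b} \<times> {a..b}) (\<lambda>z. g (y (snd z)) - g (y (fst z))
      - (g1 (y (fst z)) o\<^sub>L g (y (fst z))) (x (snd z) - x (fst z)))"
    by (intro continuous_on_diff blinfun.continuous_on cont continuous_intros) auto
  then have "continuous_on ({a..b} \<times> {a..b}) (\<lambda>(s, t). ?RY s t)"
    by (simp add: remainder_def case_prod_beta)
  moreover obtain K where K: "\<And>s t. s \<in> {a..b} \<Longrightarrow> t \<in> {a..b} \<Longrightarrow> s < t \<Longrightarrow>
      norm (remainder x y (\<lambda>t. g (y t)) s t) \<le> K * (t - s) powr (2 * \<alpha>)"
    using hR unfolding hoelder2_def by blast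
  obtain L where L: "\<And>s t. s \<in> {a..b} \<Longrightarrow> t \<in> {a..b} \<Longrightarrow> norm (x t - x s) \<le> L * \<bar>t - s\<bar> powr \<alpha>"
    using x unfolding hoelder_def by blast
  have "norm (?RY s t) \<le> (C * K + C ^ 3 * L\<^sup>2) * (t - s) powr (2 * \<alpha>)"
    if st: "s \<in> {a..b}" "t \<in> {a..b}" "s < t" for s t
  proof -
    have "(norm (x t - x s))\<^sup>2 \<le> (L * (t - s) powr \<alpha>)\<^sup>2"
      using L[OF st(1,2)] st(3) by (intro power_mono) auto
    also have "\<dots> = L\<^sup>2 * (t - s) powr (2 * \<alpha>)"
      using powr_add[of "t - s" \<alpha> \<alpha>] by (simp add: power_mult_distrib power2_eq_square)
    finally have "C ^ 3 * (norm (x t - x s))\<^sup>2 \<le> C ^ 3 * (L\<^sup>2 * (t - s) powr (2 * \<alpha>))"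
      using C_nonneg by (intro mult_left_mono) auto
    moreover have "C * norm (remainder x y (\<lambda>t. g (y t)) s t) \<le> C * (K * (t - s) powr (2 * \<alpha>))"
      using K[OF st] C_nonneg by (intro mult_left_mono) auto
    ultimately show ?thesis
      using remainder_compose_bound[of x y s t] by (simp add: algebra_simps)
  qed
  ultimately show ?thesis using hg hg1 unfolding controlled_path_def hoelder2_def by blast
qed

end

lemma C3_bounded_imp_bounded_vector_field:
  assumes "C3_bounded g g1 g2 g3"
  shows "bounded_vector_field g g1
    (Max {SUP z. norm (g z), SUP z. norm (g1 z), SUP z. norm (g2 z), SUP z. norm (g3 z)})"
    (is "bounded_vector_field g g1 ?C")
proof -
  have le: "norm (h z) \<le> ?C"
    if "bounded (range h)"
      "(SUP z. norm (h z)) \<in> {SUP z. norm (g z), SUP z. norm (g1 z), SUP z. norm (g2 z), SUP z. norm (g3 z)}"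
    for h :: "'a \<Rightarrow> 'c::real_normed_vector" and z
  proof -
    have "bdd_above (range (\<lambda>z. norm (h z)))"
      using that(1) by (auto simp: bounded_iff bdd_above_def)
    then have "norm (h z) \<le> (SUP z. norm (h z))" by (intro cSUP_upper) auto
    also have "\<dots> \<le> ?C" using that(2) by (intro Max_ge) auto
    finally show ?thesis .
  qed
  have g2: "norm (g2 z) \<le> ?C" for z using assms by (intro le) (auto simp: C3_bounded_def)
  show ?thesis
  proof
    fix z z'
    show "(g has_derivative g1 z) (at z)" using assms by (simp add: C3_bounded_def)
    show "norm (g z) \<le> ?C" "norm (g1 z) \<le> ?C"
      using assms by (intro le; auto simp: C3_bounded_def)+
    show "norm (g1 z' - g1 z) \<le> ?C * norm (z' - z)"
    proof (rule differentiable_bound[where S = UNIV and f' = g2])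
      fix w show "(g1 has_derivative g2 w) (at w within UNIV)" using assms by (simp add: C3_bounded_def)
      show "onorm (g2 w) \<le> ?C" using g2[of w] by (simp add: norm_blinfun.rep_eq)
    qed auto
  qed
qed

section \<open>The estimate on one greedy interval\<close>

text \<open>
  Here \<open>A\<close>, \<open>B\<close> stand for the variation norms of \<open>y\<close> and \<open>R\<^sup>y\<close>, \<open>l\<close> for \<open>C\<^sub>g\<close> times the rough path norm and
  \<open>I\<close> for the drift.  The smallness \<open>C\<^sub>p l \<le> 1 / 4\<close> lets \<open>B\<close> be absorbed: \<open>5/8 B \<le> I + 7/4 l\<^sup>2\<close>.
\<close>

lemma absorb_remainder:
  fixes A B I l C\<^sub>p :: real
  assumes "1 < C\<^sub>p" "0 \<le> l" "l \<le> 1 / (4 * C\<^sub>p)" "0 \<le> A" "0 \<le> B" "0 \<le> I"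
    and A: "A \<le> l + B"
    and B: "B \<le> I + l\<^sup>2 + C\<^sub>p * (l * B + l ^ 3 + 2 * l\<^sup>2 * A)"
  shows "A + B \<le> 4 * I + 3 / (4 * C\<^sub>p)"
proof -
  have cl: "C\<^sub>p * l \<le> 1 / 4" using assms(1,3) by (simp add: field_simps)
  have l: "l \<le> 1 / 4" using cl assms(1,2) mult_right_mono[of 1 C\<^sub>p l] by simp
  have "(C\<^sub>p * l) * B \<le> 1 / 4 * B" using cl assms by (intro mult_right_mono) auto
  moreover have "(C\<^sub>p * l) * l\<^sup>2 \<le> 1 / 4 * l\<^sup>2" using cl by (intro mult_right_mono) auto
  moreover have "(C\<^sub>p * l) * (2 * (l * A)) \<le> 1 / 4 * (2 * (l * A))"
    using cl assms by (intro mult_right_mono) auto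
  moreover have "l * A \<le> l * (l + B)" using A assms by (intro mult_left_mono) auto
  moreover have "l * (l + B) = l\<^sup>2 + l * B" by (simp add: algebra_simps power2_eq_square)
  moreover have "l * B \<le> 1 / 4 * B" using l assms by (intro mult_right_mono) auto
  moreover have "B \<le> I + l\<^sup>2 + ((C\<^sub>p * l) * B + (C\<^sub>p * l) * l\<^sup>2 + (C\<^sub>p * l) * (2 * (l * A)))"
    using B by (simp add: algebra_simps power2_eq_square power3_eq_cube)
  ultimately have "5 / 8 * B \<le> I + 7 / 4 * l\<^sup>2" by argo
  moreover have "l\<^sup>2 \<le> l / 4" using l assms mult_right_mono[of l "1 / 4" l] by (simp add: power2_eq_square)
  ultimately have B_le: "B \<le> 8 / 5 * I + 7 / 10 * l" by argo
  define e where "e = 1 / (4 * C\<^sub>p)"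
  have "l \<le> e" using assms(3) by (simp add: e_def)
  with A B_le assms(2,6) have "A + B \<le> 4 * I + 3 * e" by argo
  then show ?thesis by (simp add: e_def)
qed

locale rough_solution =
  rough_path_variation T x X \<nu> p a b + bounded_vector_field g g1 C
  for T :: "'m::real_normed_vector \<Rightarrow> 'm \<Rightarrow> 't::real_normed_vector"
    and x :: "real \<Rightarrow> 'm" and X :: "real \<Rightarrow> real \<Rightarrow> 't" and \<nu> p a b :: real
    and g :: "'d::banach \<Rightarrow> 'm \<Rightarrow>\<^sub>L 'd" and g1 :: "'d \<Rightarrow> 'd \<Rightarrow>\<^sub>L 'm \<Rightarrow>\<^sub>L 'd" and C :: real +
  fixes f :: "'d \<Rightarrow> 'd" and y :: "real \<Rightarrow> 'd" and \<alpha> C\<^sub>p C\<^sub>f :: real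
  assumes alpha: "0 < \<alpha>" "\<alpha> \<le> \<nu>" "\<alpha> \<le> 1 / 2" "p = 1 / \<alpha>"
    and solution: "rde_solution \<alpha> T x X f g g1 a b y"
    and compatible: "\<And>(A :: 'm \<Rightarrow>\<^sub>L 'm \<Rightarrow>\<^sub>L 'd) \<xi>. norm (tensor_apply T A \<xi>) \<le> norm A * norm \<xi>"
    and sewing: "\<And>s t J. \<lbrakk>a \<le> s; s \<le> t; t \<le> b;
        has_rough_integral T x X (\<lambda>u. g (y u)) (\<lambda>u. g1 (y u) o\<^sub>L g (y u)) s t J\<rbrakk> \<Longrightarrow>
        norm (J - g (y s) (x t - x s) - tensor_apply T (g1 (y s) o\<^sub>L g (y s)) (X s t))
        \<le> C\<^sub>p * (pvar p s t x * pvar2 (p / 2) s t (remainder x (\<lambda>u. g (y u)) (\<lambda>u. g1 (y u) o\<^sub>L g (y u)))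
            + pvar p s t (\<lambda>u. g1 (y u) o\<^sub>L g (y u)) * pvar2 (p / 2) s t X)"
    and constants: "1 < C\<^sub>p" "0 < C\<^sub>f" "0 < C"
    and f_lipschitz: "C\<^sub>f-lipschitz_on UNIV f"
begin

abbreviation "R \<equiv> remainder x y (\<lambda>t. g (y t))"
abbreviation "Y' \<equiv> \<lambda>t. g1 (y t) o\<^sub>L g (y t)"
abbreviation "RY \<equiv> remainder x (\<lambda>t. g (y t)) Y'"

text \<open>The norm \<open>|||y, R\<^sup>y|||\<close> of a controlled path.\<close>

definition K :: "real \<Rightarrow> real \<Rightarrow> real" where
  "K s t = pvar p s t y + pvar2 (p / 2) s t R"

lemma p_ge_2: "2 \<le> p"
  using alpha by (simp add: pos_le_divide_eq)

lemma hoelder_y: "hoelder \<alpha> {a..b} y" and hoelder2_R: "hoelder2 (2 * \<alpha>) {a..b} R"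
  using solution by (auto simp: rde_solution_def controlled_path_def)

lemma finite_var_y: "finite_var p a b (\<lambda>u v. y v - y u)"
  using alpha nontrivial by (intro hoelder2_finite_var[OF hoelder_increments[OF hoelder_y]]) auto

lemma finite_var_R: "finite_var (p / 2) a b R"
  using alpha nontrivial by (intro hoelder2_finite_var[OF hoelder2_R]) auto

lemma continuous_y: "continuous_on {a..b} y"
  using hoelder_continuous[OF hoelder_y] alpha by simp

lemma continuous_fy: "continuous_on {a..b} (\<lambda>u. f (y u))"
  using lipschitz_on_continuous_on[OF f_lipschitz] continuous_y
  by (auto intro: continuous_on_compose2)

lemma integrable_fy: "a \<le> s \<Longrightarrow> t \<le> b \<Longrightarrow> (\<lambda>u. f (y u)) integrable_on {s..t}"
  and integrable_norm_fy: "a \<le> s \<Longrightarrow> t \<le> b \<Longrightarrow> (\<lambda>u. norm (f (y u))) integrable_on {s..t}"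
  using continuous_on_subset[OF continuous_fy, of "{s..t}"]
  by (auto intro!: integrable_continuous_interval continuous_on_norm)

lemma increment_eq_rough_integral:
  assumes "a \<le> s" "s \<le> t" "t \<le> b"
  shows "has_rough_integral T x X (\<lambda>u. g (y u)) Y' s t (y t - y s - integral {s..t} (\<lambda>u. f (y u)))"
proof -
  have "has_rough_integral T x X (\<lambda>u. g (y u)) Y' a r (y r - y a - integral {a..r} (\<lambda>u. f (y u)))"
    if "a \<le> r" "r \<le> b" for r
    using solution that by (simp add: rde_solution_def)
  from has_rough_integral_diff[OF this[of s] this[of t]] assms
  have "has_rough_integral T x X (\<lambda>u. g (y u)) Y' s t
      (y t - y a - integral {a..t} (\<lambda>u. f (y u)) - (y s - y a - integral {a..s} (\<lambda>u. f (y u))))"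
    by simp
  moreover have "integral {a..s} (\<lambda>u. f (y u)) + integral {s..t} (\<lambda>u. f (y u))
      = integral {a..t} (\<lambda>u. f (y u))"
    using assms integrable_fy by (intro Henstock_Kurzweil_Integration.integral_combine) auto
  then have "y t - y a - integral {a..t} (\<lambda>u. f (y u)) - (y s - y a - integral {a..s} (\<lambda>u. f (y u)))
      = y t - y s - integral {s..t} (\<lambda>u. f (y u))"
    by (simp add: algebra_simps flip: \<open>_ = integral {a..t} (\<lambda>u. f (y u))\<close>)
  ultimately show ?thesis by simp
qed

abbreviation "drift \<equiv> \<lambda>s t. integral {s..t} (\<lambda>u. norm (f (y u)))"

lemma drift_nonneg: "a \<le> s \<Longrightarrow> t \<le> b \<Longrightarrow> 0 \<le> drift s t"
  using integrable_norm_fy by (intro integral_nonneg) auto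

lemma var_le_drift:
  assumes "1 \<le> r" "a \<le> s" "s \<le> t" "t \<le> b"
  shows "var_le r s t drift (drift s t)"
proof (rule var_leI)
  fix ts assume ts: "ts \<in> partitions s t"
  show "(\<Sum>(u, v)\<leftarrow>steps ts. drift u v powr r) \<le> drift s t powr r"
  proof (rule sum_steps_superadditive[OF ts, where W = "\<lambda>u v. drift u v powr r"])
    fix u v w assume uvw: "s \<le> u" "u \<le> v" "v \<le> w" "w \<le> t"
    then have "drift u v + drift v w = drift u w"
      using assms integrable_norm_fy by (intro Henstock_Kurzweil_Integration.integral_combine) auto
    moreover have "0 \<le> drift u v" "0 \<le> drift v w" using uvw assms by (auto intro!: drift_nonneg)
    ultimately show "drift u v powr r + drift v w powr r \<le> drift u w powr r"
      using powr_increment_mono[of r 0 "drift u v" "drift v w"] assms(1) by simp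
  qed simp
qed (use assms drift_nonneg in simp)

lemma remainder_bound:
  assumes "a \<le> s" "s \<le> t" "t \<le> b"
  shows "norm (R s t) \<le> drift s t + C\<^sup>2 * norm (X s t)
    + C\<^sub>p * (pvar p s t x * pvar2 (p / 2) s t RY + pvar p s t Y' * pvar2 (p / 2) s t X)"
proof -
  let ?J = "y t - y s - integral {s..t} (\<lambda>u. f (y u))"
  have "norm (R s t) = norm (integral {s..t} (\<lambda>u. f (y u)) + tensor_apply T (Y' s) (X s t)
      + (?J - g (y s) (x t - x s) - tensor_apply T (Y' s) (X s t)))"
    by (simp add: remainder_def)
  also have "\<dots> \<le> drift s t + C\<^sup>2 * norm (X s t)
    + C\<^sub>p * (pvar p s t x * pvar2 (p / 2) s t RY + pvar p s t Y' * pvar2 (p / 2) s t X)"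
  proof (intro norm_triangle_mono sewing assms increment_eq_rough_integral)
    show "norm (integral {s..t} (\<lambda>u. f (y u))) \<le> drift s t"
      using assms integrable_fy integrable_norm_fy by (intro integral_norm_bound_integral) auto
    show "norm (tensor_apply T (Y' s) (X s t)) \<le> C\<^sup>2 * norm (X s t)"
      using compatible[of "Y' s" "X s t"] mult_right_mono[OF g1g_bound[of "y s"], of "norm (X s t)"]
      by simp
  qed
  finally show ?thesis .
qed

lemma var_le_RY:
  assumes "a \<le> s" "s \<le> t" "t \<le> b"
  shows "var_le (p / 2) s t (\<lambda>u v. norm (RY u v)) (C * pvar2 (p / 2) s t R + C ^ 3 * (pvar p s t x)\<^sup>2)"
proof (rule var_le_mono)
  have "var_le p s t (\<lambda>u v. norm (x v - x u)) (pvar p s t x)"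
    unfolding pvar_def using assms exponent by (intro var_le_pvar2 finite_var_subinterval[OF finite_var_x]) auto
  then have "var_le (p / 2) s t (\<lambda>u v. (norm (x v - x u))\<^sup>2) ((pvar p s t x)\<^sup>2)"
    by (rule var_le_square) simp
  moreover have "var_le (p / 2) s t (\<lambda>u v. norm (R u v)) (pvar2 (p / 2) s t R)"
    using assms exponent by (intro var_le_pvar2 finite_var_subinterval[OF finite_var_R]) auto
  ultimately show "var_le (p / 2) s t (\<lambda>u v. C * norm (R u v) + C ^ 3 * (norm (x v - x u))\<^sup>2)
      (C * pvar2 (p / 2) s t R + C ^ 3 * (pvar p s t x)\<^sup>2)"
    using p_ge_2 C_nonneg by (intro var_le_add var_le_scale) auto
qed (use p_ge_2 remainder_compose_bound in auto)

lemma pvar_Y':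
  assumes "a \<le> s" "s \<le> t" "t \<le> b"
  shows "pvar p s t Y' \<le> 2 * C\<^sup>2 * pvar p s t y"
  unfolding pvar_def
proof (rule pvar2_le)
  have "var_le p s t (\<lambda>u v. norm (y v - y u)) (pvar2 p s t (\<lambda>u v. y v - y u))"
    using assms exponent by (intro var_le_pvar2 finite_var_subinterval[OF finite_var_y]) auto
  then have "var_le p s t (\<lambda>u v. 2 * C\<^sup>2 * norm (y v - y u)) (2 * C\<^sup>2 * pvar2 p s t (\<lambda>u v. y v - y u))"
    by (rule var_le_scale) auto
  then show "var_le p s t (\<lambda>u v. norm (Y' v - Y' u)) (2 * C\<^sup>2 * pvar2 p s t (\<lambda>u v. y v - y u))"
    by (rule var_le_mono) (use exponent g1g_lipschitz in auto)
qed (use assms exponent in auto)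

lemma finite_var_Y': "finite_var p a b (\<lambda>u v. Y' v - Y' u)"
  using hoelder2_finite_var[OF hoelder_increments[OF hoelder_lipschitz[OF hoelder_y _ g1g_lipschitz]]]
    alpha nontrivial by simp

lemma interval_estimate:
  assumes st: "a \<le> s" "s \<le> t" "t \<le> b" and small: "rp_pvar p s t x X \<le> 1 / (4 * C\<^sub>p * C)"
  shows "K s t \<le> 4 * drift s t + 3 / (4 * C\<^sub>p)"
proof -
  let ?q = "p / 2"
  define A B px PX rp where "A = pvar p s t y" and "B = pvar2 ?q s t R" and "px = pvar p s t x"
    and "PX = pvar2 ?q s t X" and "rp = rp_pvar p s t x X"
  have q: "1 \<le> ?q" "0 < ?q" using p_ge_2 by auto
  have nonneg: "0 \<le> A" "0 \<le> B" "0 \<le> px" "0 \<le> PX" "0 \<le> rp"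
    by (simp_all add: A_def B_def px_def PX_def rp_def)
  note sub = finite_var_subinterval[OF _ st]
  have vX: "var_le ?q s t (\<lambda>u v. norm (X u v)) PX"
    and vR: "var_le ?q s t (\<lambda>u v. norm (R u v)) B"
    unfolding PX_def B_def using q by (intro var_le_pvar2 sub finite_var_X finite_var_R; simp)+
  have vx: "var_le p s t (\<lambda>u v. norm (x v - x u)) px"
    unfolding px_def pvar_def using exponent by (intro var_le_pvar2 sub finite_var_x) auto
  have fRY: "finite_var ?q s t RY"
    using var_le_RY[OF st] by (auto simp: finite_var_def)
  have RY_le: "pvar2 ?q s t RY \<le> C * B + C ^ 3 * px\<^sup>2"
    unfolding B_def px_def using var_le_RY[OF st] q st by (intro pvar2_le)

  \<comment> \<open>The sewing error on a step \<open>[u,v]\<close> is a sum of two products; in each, the \<open>p\<close>-variation is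
    replaced by its value on \<open>[s,t]\<close> and the \<open>q\<close>-variation is kept, as its \<open>q\<close>-th power is superadditive.\<close>
  have "var_le ?q s t (\<lambda>u v. drift u v + C\<^sup>2 * norm (X u v)
      + (C\<^sub>p * px * pvar2 ?q u v RY + C\<^sub>p * pvar p s t Y' * pvar2 ?q u v X))
      (drift s t + C\<^sup>2 * PX + (C\<^sub>p * px * pvar2 ?q s t RY + C\<^sub>p * pvar p s t Y' * PX))"
  proof (intro var_le_add var_le_scale vX var_le_drift st q)
    show "var_le ?q s t (\<lambda>u v. pvar2 ?q u v RY) (pvar2 ?q s t RY)"
      by (rule var_le_interval_pvar2[OF q(2) fRY])
    show "var_le ?q s t (\<lambda>u v. pvar2 ?q u v X) PX"
      unfolding PX_def by (rule var_le_interval_pvar2[OF q(2) sub[OF finite_var_X]])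
  qed (use st nonneg constants drift_nonneg in auto)
  then have "var_le ?q s t (\<lambda>u v. norm (R u v))
      (drift s t + C\<^sup>2 * PX + (C\<^sub>p * px * pvar2 ?q s t RY + C\<^sub>p * pvar p s t Y' * PX))"
  proof (rule var_le_mono[OF _ q(2)])
    fix u v assume uv: "s \<le> u" "u < v" "v \<le> t"
    have "pvar p u v x \<le> px" unfolding px_def pvar_def
      using uv exponent by (intro pvar2_mono sub finite_var_x) auto
    moreover have "pvar p u v Y' \<le> pvar p s t Y'" unfolding pvar_def
      using uv exponent by (intro pvar2_mono sub finite_var_Y') auto
    ultimately have "C\<^sub>p * (pvar p u v x * pvar2 ?q u v RY + pvar p u v Y' * pvar2 ?q u v X)
        \<le> C\<^sub>p * (px * pvar2 ?q u v RY + pvar p s t Y' * pvar2 ?q u v X)"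
      using constants by (intro mult_left_mono add_mono mult_right_mono) auto
    then show "0 \<le> norm (R u v) \<and> norm (R u v) \<le> drift u v + C\<^sup>2 * norm (X u v)
        + (C\<^sub>p * px * pvar2 ?q u v RY + C\<^sub>p * pvar p s t Y' * pvar2 ?q u v X)"
      using remainder_bound[of u v] uv st by (simp add: algebra_simps)
  qed
  then have "B \<le> drift s t + C\<^sup>2 * PX + (C\<^sub>p * px * pvar2 ?q s t RY + C\<^sub>p * pvar p s t Y' * PX)"
    unfolding B_def using q st by (intro pvar2_le)
  also have "\<dots> \<le> drift s t + C\<^sup>2 * PX
      + (C\<^sub>p * px * (C * B + C ^ 3 * px\<^sup>2) + C\<^sub>p * (2 * C\<^sup>2 * A) * PX)"
    using RY_le pvar_Y'[OF st] constants nonneg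
    by (intro add_mono mult_mono order_refl) (auto simp: A_def)
  also have "\<dots> = drift s t + C\<^sup>2 * PX
      + C\<^sub>p * ((C * px) * B + (C * px) ^ 3 + 2 * (C\<^sup>2 * PX) * A)"
    by (simp add: algebra_simps power2_eq_square power3_eq_cube)
  also have "\<dots> \<le> drift s t + (C * rp)\<^sup>2
      + C\<^sub>p * ((C * rp) * B + (C * rp) ^ 3 + 2 * (C * rp)\<^sup>2 * A)"
  proof -
    have "C * px \<le> C * rp"
      unfolding px_def rp_def using C_nonneg exponent by (intro mult_left_mono pvar_le_rp_pvar) auto
    moreover have "C\<^sup>2 * PX \<le> (C * rp)\<^sup>2"
      unfolding PX_def rp_def power_mult_distrib
      using exponent by (intro mult_left_mono pvar2_le_rp_pvar_square) auto
    ultimately show ?thesis using constants nonneg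
      by (intro add_mono mult_left_mono mult_right_mono power_mono) auto
  qed
  finally have B_le: "B \<le> drift s t + (C * rp)\<^sup>2
      + C\<^sub>p * ((C * rp) * B + (C * rp) ^ 3 + 2 * (C * rp)\<^sup>2 * A)" .

  have "var_le p s t (\<lambda>u v. C * norm (x v - x u) + norm (R u v)) (C * px + B)"
    using vx vR C_nonneg p_ge_2 by (intro var_le_add var_le_scale var_le_exponent_mono[OF q(2) _ vR]) auto
  then have "var_le p s t (\<lambda>u v. norm (y v - y u)) (C * px + B)"
  proof (rule var_le_mono)
    fix u v
    have "norm (y v - y u) \<le> norm (g (y u) (x v - x u)) + norm (R u v)"
      using norm_triangle_ineq[of "g (y u) (x v - x u)" "R u v"] by (simp add: remainder_def)
    moreover have "norm (g (y u) (x v - x u)) \<le> C * norm (x v - x u)"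
      using norm_blinfun[of "g (y u)" "x v - x u"] mult_right_mono[OF g_bound[of "y u"]]
      by (meson norm_ge_zero order_trans)
    ultimately show "0 \<le> norm (y v - y u) \<and> norm (y v - y u) \<le> C * norm (x v - x u) + norm (R u v)"
      by simp
  qed (use exponent in simp)
  then have "A \<le> C * px + B" unfolding A_def pvar_def using exponent st by (intro pvar2_le)
  also have "\<dots> \<le> C * rp + B"
    unfolding px_def rp_def using C_nonneg exponent by (intro add_mono mult_left_mono pvar_le_rp_pvar) auto
  finally have A_le: "A \<le> C * rp + B" .

  have "C * rp \<le> C * (1 / (4 * C\<^sub>p * C))" using small C_nonneg unfolding rp_def by (rule mult_left_mono)
  then have "C * rp \<le> 1 / (4 * C\<^sub>p)" using constants by simp
  from absorb_remainder[OF constants(1) _ this _ _ _ A_le B_le] show ?thesis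
    using nonneg C_nonneg drift_nonneg st by (simp add: K_def A_def B_def)
qed

section \<open>Gluing the greedy intervals\<close>

lemma K_nonneg: "0 \<le> K s t"
  by (simp add: K_def)

lemma rp_pvar_mono:
  assumes "a \<le> s" "s \<le> t'" "t' \<le> t" "t \<le> b"
  shows "rp_pvar p s t' x X \<le> rp_pvar p s t x X"
proof -
  have "pvar p s t' x \<le> pvar p s t x" unfolding pvar_def
    using assms exponent by (intro pvar2_mono finite_var_subinterval[OF finite_var_x]) auto
  moreover have "pvar2 (p / 2) s t' X \<le> pvar2 (p / 2) s t X"
    using assms exponent by (intro pvar2_mono finite_var_subinterval[OF finite_var_X]) auto
  ultimately show ?thesis
    unfolding rp_pvar_def using exponent by (intro powr_mono2 add_mono) auto
qed

lemma norm_y_le: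
  assumes "a \<le> s" "s \<le> u" "u \<le> t" "t \<le> b"
  shows "norm (y u) \<le> norm (y s) + K s t"
proof (cases "s = u")
  case False
  have "norm (y u - y s) \<le> pvar p s t y" unfolding pvar_def
    using norm_le_pvar2[of p s t "\<lambda>u v. y v - y u" s u] assms False exponent
      finite_var_subinterval[OF finite_var_y, of s t] by auto
  moreover have "norm (y u) \<le> norm (y s) + norm (y u - y s)"
    using norm_triangle_sub[of "y u" "y s"] by simp
  ultimately show ?thesis 
    using pvar2_nonneg[of "p / 2" s t R] by (simp only: K_def)
qed (simp add: K_nonneg)

abbreviation "\<Phi> \<equiv> norm (f 0) / C\<^sub>f"

lemma norm_f_le: "norm (f z) \<le> C\<^sub>f * (norm z + \<Phi>)"
proof -
  have "norm (f z) \<le> norm (f 0) + dist (f z) (f 0)"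
    using norm_triangle_sub[of "f z" "f 0"] by (simp add: dist_norm)
  also have "dist (f z) (f 0) \<le> C\<^sub>f * norm z"
    using lipschitz_onD[OF f_lipschitz, of z 0] by simp
  finally show ?thesis using constants by (simp add: algebra_simps)
qed

text \<open>
  The exponential comes from Gronwall applied to \<open>\<parallel>y\<^sub>u\<parallel> + \<Phi>\<close>, not to the variation norm, so that continuity
  of \<open>y\<close> is enough; the variation norm then inherits the bound through the drift integral.
\<close>

lemma interval_growth:
  assumes st: "a \<le> s" "s \<le> t" "t \<le> b" and small: "rp_pvar p s t x X \<le> 1 / (4 * C\<^sub>p * C)"
  shows "norm (y s) + K s t + \<Phi>
    \<le> (norm (y s) + \<Phi> + 3 / (4 * C\<^sub>p)) * exp (4 * C\<^sub>f * (t - s))"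
proof -
  let ?m = "\<lambda>u. norm (y u) + \<Phi>" and ?c = "norm (y s) + \<Phi> + 3 / (4 * C\<^sub>p)"
  have cont: "continuous_on {s..t} ?m"
    using continuous_on_subset[OF continuous_y, of "{s..t}"] st by (intro continuous_intros) auto
  have bound: "K s u + norm (y s) + \<Phi> \<le> ?c + 4 * C\<^sub>f * integral {s..u} ?m"
    if u: "s \<le> u" "u \<le> t" for u
  proof -
    have "rp_pvar p s u x X \<le> 1 / (4 * C\<^sub>p * C)"
      using rp_pvar_mono[of s u t] u st small by simp
    then have "K s u \<le> 4 * drift s u + 3 / (4 * C\<^sub>p)"
      using interval_estimate[of s u] u st by simp
    moreover have "drift s u \<le> integral {s..u} (\<lambda>u. C\<^sub>f * ?m u)"
      using u st integrable_norm_fy norm_f_le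
        integrable_continuous_interval[OF continuous_on_subset[OF cont, of "{s..u}"]]
      by (intro integral_le integrable_on_mult_right) auto
    ultimately show ?thesis by simp
  qed
  have "?c + 4 * C\<^sub>f * integral {s..t} ?m \<le> ?c * exp (4 * C\<^sub>f * (t - s))"
  proof (rule gronwall_integral[OF st(2) cont])
    fix u assume u: "s \<le> u" "u \<le> t"
    show "?m u \<le> ?c + 4 * C\<^sub>f * integral {s..u} ?m"
      using bound[OF u] norm_y_le[of s u u] u st by simp
  qed (use constants in simp)
  with bound[OF st(2) order_refl] show ?thesis by simp
qed

text \<open>
  The defect of additivity of \<open>R\<close> is \<open>(g(y\<^sub>u) - g(y\<^sub>v)) x\<^sub>u\<^sub>w\<close>.  Bounding the first factor by \<open>2 C\<close> makes the
  price of a cut independent of \<open>y\<close>.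
\<close>

lemma cut_remainder:
  assumes "a \<le> v" "v < u" "u < w" "w \<le> t" "t \<le> b" and small: "rp_pvar p u t x X \<le> 1 / (4 * C\<^sub>p * C)"
  shows "norm (R v w) \<le> norm (R v u) + norm (R u w) + 1 / (2 * C\<^sub>p)"
proof -
  have "norm (x w - x u) \<le> pvar p u t x" unfolding pvar_def
    using norm_le_pvar2[of p u t "\<lambda>u v. x v - x u" u w] assms exponent
      finite_var_subinterval[OF finite_var_x, of u t] by auto
  also have "\<dots> \<le> 1 / (4 * C\<^sub>p * C)"
    using pvar_le_rp_pvar[OF exponent(3)] small order_trans by blast
  finally have x_le: "norm (x w - x u) \<le> 1 / (4 * C\<^sub>p * C)" .
  have "norm ((g (y u) - g (y v)) (x w - x u)) \<le> norm (g (y u) - g (y v)) * norm (x w - x u)"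
    by (rule norm_blinfun)
  also have "\<dots> \<le> (C + C) * (1 / (4 * C\<^sub>p * C))"
  proof (rule mult_mono[OF _ x_le])
    show "norm (g (y u) - g (y v)) \<le> C + C"
      using norm_triangle_ineq4[of "g (y u)" "g (y v)"] g_bound[of "y u"] g_bound[of "y v"] by simp
  qed (use C_nonneg in auto)
  also have "\<dots> = 1 / (2 * C\<^sub>p)" using constants by (simp add: field_simps)
  finally have "norm ((g (y u) - g (y v)) (x w - x u)) \<le> 1 / (2 * C\<^sub>p)" .
  moreover have "R v w = R v u + R u w + (g (y u) - g (y v)) (x w - x u)"
    by (simp add: remainder_def blinfun.diff_left blinfun.diff_right)
  ultimately show ?thesis by (metis norm_triangle_mono order_refl)
qed

context
  fixes \<tau> :: "nat \<Rightarrow> real"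
  assumes \<tau>_0: "\<tau> 0 = a" and \<tau>_mono: "\<And>i. \<tau> i \<le> \<tau> (Suc i)" and \<tau>_le: "\<And>i. \<tau> i \<le> b"
    and \<tau>_small: "\<And>i. rp_pvar p (\<tau> i) (\<tau> (Suc i)) x X \<le> 1 / (4 * C\<^sub>p * C)"
begin

lemma \<tau>_ge: "a \<le> \<tau> i"
  using lift_Suc_mono_le[of \<tau>, OF \<tau>_mono, of 0 i] by (simp add: \<tau>_0)

lemma norm_y_le_sum:
  "a \<le> t \<Longrightarrow> t \<le> \<tau> n \<Longrightarrow> norm (y t) \<le> norm (y a) + (\<Sum>i<n. K (\<tau> i) (\<tau> (Suc i)))"
proof (induction n arbitrary: t)
  case 0
  then have "t = a" by (simp add: \<tau>_0)
  then show ?case by simp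
next
  case (Suc n)
  show ?case
  proof (cases "t \<le> \<tau> n")
    case True
    then show ?thesis using Suc.IH[of t] Suc.prems K_nonneg[of "\<tau> n" "\<tau> (Suc n)"] by simp
  next
    case False
    then have "norm (y t) \<le> norm (y (\<tau> n)) + K (\<tau> n) (\<tau> (Suc n))"
      using norm_y_le \<tau>_ge \<tau>_le Suc.prems by simp
    with Suc.IH[of "\<tau> n"] \<tau>_ge show ?thesis by simp
  qed
qed

lemma sum_K_le:
  "norm (y a) + (\<Sum>i<n. K (\<tau> i) (\<tau> (Suc i))) + \<Phi>
     \<le> (norm (y a) + \<Phi> + real n * (3 / (4 * C\<^sub>p))) * exp (4 * C\<^sub>f * (\<tau> n - a))"
proof (induction n)
  case (Suc n)
  define S where "S = norm (y a) + (\<Sum>i<n. K (\<tau> i) (\<tau> (Suc i)))"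
  define d where "d = 3 / (4 * C\<^sub>p)"
  define e where "e = exp (4 * C\<^sub>f * (\<tau> (Suc n) - \<tau> n))"
  define E where "E = exp (4 * C\<^sub>f * (\<tau> n - a))"
  have e: "1 \<le> e" "1 \<le> E" "0 \<le> d"
    using \<tau>_mono \<tau>_ge constants by (auto simp: e_def E_def d_def)
  \<comment> \<open>In the local bound \<open>\<parallel>y\<parallel>\<close> at the left end point has coefficient \<open>e - 1 \<ge> 0\<close> once it is moved to the
    right, so it may be replaced by the larger \<open>S\<close>.\<close>
  have "norm (y (\<tau> n)) \<le> S" using norm_y_le_sum[of "\<tau> n" n] \<tau>_ge by (simp add: S_def)
  then have "norm (y (\<tau> n)) * (e - 1) \<le> S * (e - 1)" using e by (intro mult_right_mono) auto
  moreover have "norm (y (\<tau> n)) + K (\<tau> n) (\<tau> (Suc n)) + \<Phi> \<le> (norm (y (\<tau> n)) + \<Phi> + d) * e"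
    unfolding d_def e_def using \<tau>_ge \<tau>_mono \<tau>_le \<tau>_small by (intro interval_growth)
  ultimately have "S + K (\<tau> n) (\<tau> (Suc n)) + \<Phi> \<le> (S + \<Phi> + d) * e"
    by (simp add: algebra_simps)
  also have "\<dots> \<le> ((norm (y a) + \<Phi> + real n * d) * E + d * E) * e"
    using Suc.IH e mult_left_mono[of 1 E d] by (intro mult_right_mono add_mono) (auto simp: S_def d_def E_def)
  also have "\<dots> = (norm (y a) + \<Phi> + real (Suc n) * d) * (E * e)" by (simp add: algebra_simps)
  also have "E * e = exp (4 * C\<^sub>f * (\<tau> (Suc n) - a))"
    by (simp add: E_def e_def algebra_simps flip: exp_add)
  finally show ?case by (simp add: S_def d_def)
qed (simp add: \<tau>_0)

lemma K_le_sum: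
  "K a (\<tau> (Suc n)) \<le> (\<Sum>i<Suc n. K (\<tau> i) (\<tau> (Suc i))) + real n * (1 / (2 * C\<^sub>p))"
proof (induction n)
  case (Suc n)
  let ?u = "\<tau> (Suc n)" and ?t = "\<tau> (Suc (Suc n))"
  have order: "a \<le> ?u" "?u \<le> ?t" "?t \<le> b" by (auto intro: \<tau>_ge \<tau>_mono \<tau>_le)
  have "pvar2 (p / 2) a ?t R \<le> pvar2 (p / 2) a ?u R + pvar2 (p / 2) ?u ?t R + 1 / (2 * C\<^sub>p)"
    using p_ge_2 constants order \<tau>_small[of "Suc n"]
    by (intro pvar2_concat cut_remainder[where t = ?t] finite_var_subinterval[OF finite_var_R]) auto
  moreover have "pvar p a ?t y \<le> pvar p a ?u y + pvar p ?u ?t y + 0" unfolding pvar_def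
  proof (intro pvar2_concat finite_var_subinterval[OF finite_var_y])
    fix v w
    show "norm (y w - y v) \<le> norm (y ?u - y v) + norm (y w - y ?u) + 0"
      using norm_triangle_ineq[of "y ?u - y v" "y w - y ?u"] by simp
  qed (use p_ge_2 order in auto)
  ultimately have "K a ?t \<le> K a ?u + K ?u ?t + 1 / (2 * C\<^sub>p)" by (simp add: K_def)
  moreover have "real (Suc n) * (1 / (2 * C\<^sub>p)) = real n * (1 / (2 * C\<^sub>p)) + 1 / (2 * C\<^sub>p)"
    by (simp add: distrib_right add_divide_distrib)
  ultimately show ?case using Suc.IH by simp
qed (simp add: \<tau>_0)

end

lemma solution_bounds:
  fixes N :: nat
  assumes N: "N = greedy_count (1 / (4 * C\<^sub>p * C)) p a b x X"
  shows "(SUP t\<in>{a..b}. norm (y t))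
      \<le> (norm (y a) + (\<Phi> + 1 / C\<^sub>p) * real N) * exp (4 * C\<^sub>f * (b - a))"
    and "pvar p a b y + pvar2 (p / 2) a b R
      \<le> (norm (y a) + (\<Phi> + 1 / C\<^sub>p) * real N) * exp (4 * C\<^sub>f * (b - a)) * real N powr ((p - 1) / p)
        - norm (y a)"
proof -
  let ?\<gamma> = "1 / (4 * C\<^sub>p * C)"
  have \<gamma>: "0 < ?\<gamma>" using constants by simp
  define \<tau> where "\<tau> = greedy_time ?\<gamma> p a b x X"
  have \<tau>: "\<tau> 0 = a" "\<And>i. \<tau> i \<le> \<tau> (Suc i)" "\<And>i. \<tau> i \<le> b"
    "\<And>i. rp_pvar p (\<tau> i) (\<tau> (Suc i)) x X \<le> ?\<gamma>"
    using greedy_time_bounds[OF \<gamma>] greedy_time_step[OF \<gamma>] unfolding \<tau>_def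
    by (auto simp del: greedy_time.simps(2))
  have \<tau>_N: "\<tau> N = b" using greedy_count_attained[OF \<gamma>] by (simp add: N \<tau>_def)
  then obtain n where n: "N = Suc n" using \<tau>(1) nontrivial by (cases N) auto
  define Z E e where "Z = norm (y a)" and "E = exp (4 * C\<^sub>f * (b - a))" and "e = 1 / C\<^sub>p"
  define S where "S = (\<Sum>i<N. K (\<tau> i) (\<tau> (Suc i)))"
  have nonneg: "0 \<le> Z" "0 \<le> \<Phi>" "0 \<le> e" "1 \<le> E"
    using constants nontrivial by (auto simp: Z_def e_def E_def)
  have S: "Z + S + \<Phi> \<le> (Z + \<Phi> + real N * (3 / 4 * e)) * E"
    using sum_K_le[of \<tau>, OF \<tau>, of N] by (simp add: Z_def S_def E_def e_def \<tau>_N)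
  have \<Phi>_le: "\<Phi> \<le> \<Phi> * real N" 
    using mult_left_mono[of 1 "real N" \<Phi>] nonneg n by simp

  have "norm (y t) \<le> (Z + (\<Phi> + e) * real N) * E" if t: "t \<in> {a..b}" for t
  proof -
    have "norm (y t) \<le> Z + S + \<Phi>"
      using norm_y_le_sum[of \<tau>, OF \<tau>, of t N] t \<tau>_N nonneg by (simp add: Z_def S_def)
    also have "\<dots> \<le> (Z + \<Phi> + real N * (3 / 4 * e)) * E" by (rule S)
    also have "\<dots> \<le> (Z + (\<Phi> + e) * real N) * E"
    proof (rule mult_right_mono)
      have "real N * (3 / 4 * e) \<le> e * real N" using nonneg mult_right_mono[of "3 / 4" 1 "e * real N"] by simp
      then show "Z + \<Phi> + real N * (3 / 4 * e) \<le> Z + (\<Phi> + e) * real N"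
        using \<Phi>_le by (simp only: distrib_right)
    qed (use nonneg in simp)
    finally show ?thesis .
  qed
  then show "(SUP t\<in>{a..b}. norm (y t))
      \<le> (norm (y a) + (\<Phi> + 1 / C\<^sub>p) * real N) * exp (4 * C\<^sub>f * (b - a))"
    unfolding Z_def E_def e_def using nontrivial by (intro cSUP_least) auto

  define M where "M = real N powr ((p - 1) / p)"
  \<comment> \<open>\<open>3/4\<close> per interval from the local estimate and \<open>1/2\<close> per cut must fit below \<open>N M\<close>.  Without cuts
    \<open>M \<ge> 1\<close> suffices; otherwise \<open>N \<ge> 2\<close> and \<open>M \<ge> \<surd>2 \<ge> 3/4 + 1/2\<close>.\<close>
  have M: "3 / 4 * real N + 1 / 2 * real n \<le> real N * M" "1 \<le> M"
  proof -
    have exponent_ge: "1 / 2 \<le> (p - 1) / p" using p_ge_2 by (simp add: field_simps)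
    then have "0 \<le> (p - 1) / p" by linarith
    then show "1 \<le> M" unfolding M_def using n by (intro ge_one_powr_ge_zero) auto
    show "3 / 4 * real N + 1 / 2 * real n \<le> real N * M"
    proof (cases "n = 0")
      case False
      then have "2 powr (1 / 2) \<le> real N powr (1 / 2)" using n by (intro powr_mono2) auto
      also have "\<dots> \<le> M" unfolding M_def using exponent_ge n by (intro powr_mono) auto
      finally have "sqrt 2 \<le> M" by (simp add: powr_half_sqrt)
      moreover have "5 / 4 \<le> sqrt 2" by (rule real_le_rsqrt) (simp add: power2_eq_square)
      ultimately have "real N * (5 / 4) \<le> real N * M" by (intro mult_left_mono) auto
      moreover have "3 / 4 * real N + 1 / 2 * real n \<le> real N * (5 / 4)" using n by simp
      ultimately show ?thesis by (rule order_trans[rotated])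
    qed (use n \<open>1 \<le> M\<close> in simp)
  qed
  have "K a b \<le> S + real n * (1 / 2 * e)"
    using K_le_sum[of \<tau>, OF \<tau>, of n] by (simp add: S_def e_def n \<tau>_N[unfolded n])
  also have "\<dots> \<le> (Z + \<Phi> + real N * (3 / 4 * e)) * E - Z + real n * (1 / 2 * e) * E"
    using S nonneg mult_left_mono[of 1 E "real n * (1 / 2 * e)"] by simp
  also have "\<dots> = (Z + \<Phi>) * E + (3 / 4 * real N + 1 / 2 * real n) * (e * E) - Z"
    by (simp add: algebra_simps)
  also have "\<dots> \<le> (Z + \<Phi> * real N) * E * M + real N * M * (e * E) - Z"
  proof -
    have "(Z + \<Phi>) * E \<le> (Z + \<Phi> * real N) * E" using \<Phi>_le nonneg by (intro mult_right_mono) auto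
    also have "\<dots> \<le> (Z + \<Phi> * real N) * E * M"
    proof -
      have "0 \<le> Z + \<Phi> * real N" using nonneg \<Phi>_le by linarith
      then have "0 \<le> (Z + \<Phi> * real N) * E" using nonneg by simp
      from mult_left_mono[OF M(2) this] show ?thesis by simp
    qed
    finally show ?thesis
      using M(1) nonneg by (intro diff_right_mono add_mono mult_right_mono) auto
  qed
  also have "\<dots> = (Z + (\<Phi> + e) * real N) * E * M - Z" by (simp add: algebra_simps)
  finally show "pvar p a b y + pvar2 (p / 2) a b R
      \<le> (norm (y a) + (\<Phi> + 1 / C\<^sub>p) * real N) * exp (4 * C\<^sub>f * (b - a)) * real N powr ((p - 1) / p)
        - norm (y a)"
    by (simp only: K_def Z_def E_def e_def M_def)
qed

end

section \<open>The a priori bounds for the solution\<close>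

theorem theorem3p8:
  fixes T :: "'m::banach \<Rightarrow> 'm \<Rightarrow> 't::banach"
    and f :: "'d::banach \<Rightarrow> 'd"
    and g :: "'d \<Rightarrow> 'm \<Rightarrow>\<^sub>L 'd"
    and g1 :: "'d \<Rightarrow> 'd \<Rightarrow>\<^sub>L 'm \<Rightarrow>\<^sub>L 'd"
    and g2 :: "'d \<Rightarrow> 'd \<Rightarrow>\<^sub>L 'd \<Rightarrow>\<^sub>L 'm \<Rightarrow>\<^sub>L 'd"
    and g3 :: "'d \<Rightarrow> 'd \<Rightarrow>\<^sub>L 'd \<Rightarrow>\<^sub>L 'd \<Rightarrow>\<^sub>L 'm \<Rightarrow>\<^sub>L 'd"
    and x :: "real \<Rightarrow> 'm" and X :: "real \<Rightarrow> real \<Rightarrow> 't"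
    and y :: "real \<Rightarrow> 'd"
    and \<alpha> \<nu> p q C\<^sub>p C\<^sub>f C\<^sub>g \<gamma> a b :: real and N :: nat
  assumes findim: "finite_dim TYPE('m)" "finite_dim TYPE('d)"
    and tensor: "is_tensor_product T"
    and compatible: "\<And>(A :: 'm \<Rightarrow>\<^sub>L 'm \<Rightarrow>\<^sub>L 'd) \<xi>. norm (tensor_apply T A \<xi>) \<le> norm A * norm \<xi>"
    and exponents: "1 / 3 < \<alpha>" "\<alpha> < \<nu>" "\<nu> < 1 / 2" "p = 1 / \<alpha>" "q = p / 2"
    and C\<^sub>p_gt_1: "C\<^sub>p > 1"
    and C\<^sub>p: "\<And>a' b' x' X' (Y :: real \<Rightarrow> 'm \<Rightarrow>\<^sub>L 'd) Y' s t J.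
        \<lbrakk>rough_path \<nu> T a' b' x' X'; controlled_path \<alpha> x' a' b' Y Y';
         a' \<le> s; s \<le> t; t \<le> b'; has_rough_integral T x' X' Y Y' s t J\<rbrakk> \<Longrightarrow>
        norm (J - Y s (x' t - x' s) - tensor_apply T (Y' s) (X' s t))
        \<le> C\<^sub>p * (pvar p s t x' * pvar2 q s t (remainder x' Y Y') + pvar p s t Y' * pvar2 q s t X')"
    and f: "C\<^sub>f > 0" "C\<^sub>f-lipschitz_on UNIV f"
    and g: "C3_bounded g g1 g2 g3"
    and C\<^sub>g: "C\<^sub>g = Max {SUP z. norm (g z), SUP z. norm (g1 z), SUP z. norm (g2 z), SUP z. norm (g3 z)}"
      "C\<^sub>g > 0"
    and interval: "a < b"
    and x: "rough_path \<nu> T a b x X"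
    and y: "rde_solution \<alpha> T x X f g g1 a b y"
    and \<gamma>: "\<gamma> = 1 / (4 * C\<^sub>p * C\<^sub>g)"
    and N: "N = greedy_count \<gamma> p a b x X"
  shows "(SUP t\<in>{a..b}. norm (y t))
           \<le> (norm (y a) + (norm (f 0) / C\<^sub>f + 1 / C\<^sub>p) * real N) * exp (4 * C\<^sub>f * (b - a)) \<and>
         pvar p a b y + pvar2 q a b (remainder x y (\<lambda>t. g (y t)))
           \<le> (norm (y a) + (norm (f 0) / C\<^sub>f + 1 / C\<^sub>p) * real N) * exp (4 * C\<^sub>f * (b - a))
               * real N powr ((p - 1) / p) - norm (y a)"
proof -
  have "0 < \<alpha>" "0 < \<nu>" "\<alpha> \<le> 1 / 2" using exponents(1-3) by linarith+
  then have "0 < p" "1 \<le> \<nu> * p" using exponents(2,4) by simp_all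
  interpret bounded_vector_field g g1 C\<^sub>g
    using C3_bounded_imp_bounded_vector_field[OF g] by (simp add: C\<^sub>g)
  interpret rough_solution T x X \<nu> p a b g g1 C\<^sub>g f y \<alpha> C\<^sub>p C\<^sub>f
  proof
    fix s t J
    assume st: "a \<le> s" "s \<le> t" "t \<le> b"
      and J: "has_rough_integral T x X (\<lambda>u. g (y u)) (\<lambda>u. g1 (y u) o\<^sub>L g (y u)) s t J"
    have "hoelder \<alpha> {a..b} x"
      using x exponents by (auto simp: rough_path_def intro: hoelder_exponent_mono)
    then have "controlled_path \<alpha> x a b (\<lambda>u. g (y u)) (\<lambda>u. g1 (y u) o\<^sub>L g (y u))"
      using y \<open>0 < \<alpha>\<close> by (intro controlled_path_compose) (auto simp: rde_solution_def)
    from C\<^sub>p[OF x this st J] show "norm (J - g (y s) (x t - x s) - tensor_apply T (g1 (y s) o\<^sub>L g (y s)) (X s t))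
        \<le> C\<^sub>p * (pvar p s t x * pvar2 (p / 2) s t (remainder x (\<lambda>u. g (y u)) (\<lambda>u. g1 (y u) o\<^sub>L g (y u)))
            + pvar p s t (\<lambda>u. g1 (y u) o\<^sub>L g (y u)) * pvar2 (p / 2) s t X)"
      by (simp only: exponents(5))
  qed (use x y f interval exponents compatible C\<^sub>p_gt_1 C\<^sub>g(2) \<open>0 < \<nu>\<close> \<open>0 < p\<close> \<open>1 \<le> \<nu> * p\<close> \<open>0 < \<alpha>\<close> \<open>\<alpha> \<le> 1 / 2\<close> in auto)
  show ?thesis
    using solution_bounds[OF N[unfolded \<gamma>]] by (simp only: exponents(5))
qed

end
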